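(* For the $k$-variable polynomial semiring $\mathbb{Z}_{\max}[\pmb x]$ and the $k$-variable Laurent polynomial semiring $\mathbb{Z}_{\max}(\pmb x)$ we have that: (i) The minimal primes of $\mathbb{Z}_{\max}(\pmb x)$ (resp. $\mathbb{Z}_{\max}[\pmb x]$) are of the form $P(U)_{\mathbb{Z}}$ (resp. $P[U]_{\mathbb{Z}}$) for a z-admissible matrix $U$ with $k+1$ columns satisfying $\mathrm{Ker}(U)\cap\mathbb{Z}^{k+1}=\{\pmb 0\}$. (ii) $\dim(\mathbb{Z}_{\max}(\pmb x))=\dim(\mathbb{Z}_{\max}[\pmb x])=k+1$. (iii) For any $f,g\in\mathbb{Z}_{\max}(\pmb x)$ (resp. $f,g\in\mathbb{Z}_{\max}[\pmb x]$) the pair $(f,g)$ lies in the radical of the trivial congruence of $\mathbb{Z}_{\max}(\pmb x)$ (resp. $\mathbb{Z}_{\max}[\pmb x]$) if and only if $\overline{newt(f)}=\overline{newt(g)}$. (iv) Every proper radical congruence of $\mathbb{Z}_{\max}(\pmb x)$ is QC. The congruence $\mathrm{Rad}(\Delta)$ in $\mathbb{Z}_{\max}[\pmb x]$ is QC.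
   Context: A semiring is a commutative semiring with additive identity $0$ and multiplicative identity $1$, with $1\neq 0$ and $a\cdot 0=0$ for all $a$; a $\mathbb{B}$-algebra is a semiring with idempotent addition. $\mathbb{B}=\{0,1\}$ is the two-element semifield with $1+1=1$. $\mathbb{Z}_{\max}$ is the semifield on $\mathbb{Z}\cup\{-\infty\}$ with maximum as addition and usual addition as multiplication; its elements are written $t^c$ ($c\in\mathbb{Z}$) and $0$ (for $-\infty$), so $1=t^0$. For a semifield $F$ and $\pmb x=(x_1,\dots,x_k)$, $F[\pmb x]$ (resp. $F(\pmb x)$) is the semiring of formal polynomials (resp. Laurent polynomials), i.e. formal $F$-linear combinations of monomials $\pmb x^{\pmb n}$ with $\pmb n\in\mathbb{N}^k$ (resp. $\pmb n\in\mathbb{Z}^k$), where $0\in\mathbb{N}$. A congruence of $A$ is an equivalence relation $I\subseteq A\times A$ compatible with addition and multiplication; it is proper if $I\ne A\times A$; $\Delta$ is the trivial congruence (the diagonal). A congruence $P$ is prime if it is proper and for all pairs $\alpha,\beta\in A\times A$ such that the twisted product $\alpha\beta=(\alpha_1\beta_1+\alpha_2\beta_2,\alpha_1\beta_2+\alpha_2\beta_1)$ is in $P$, we have $\alpha\in P$ or $\beta\in P$; minimal primes are minimal with respect to inclusion. $\dim(A)$ is the length (number of strict inclusions) of the longest chain of prime congruences of $A$. $\mathrm{Rad}(I)$ is the intersection of all prime congruences containing $I$ (an empty intersection being $A\times A$), and $I$ is radical if $\mathrm{Rad}(I)=I$. $I$ is QC if it is proper and $A/I$ is cancellative, i.e.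 $ab=ac$ in $A/I$ implies $a=0$ or $b=c$. A real matrix $U$ with $k+1$ columns is admissible if for each row index $i$ there is $\pmb n\in\mathbb{Z}^{k+1}$ such that the first non-zero coordinate of $U\pmb n$ is the $i$-th one (the matrix with zero rows is allowed); it is z-admissible if moreover its first column either has all entries $0$ or has positive first non-zero entry. For a z-admissible $U$, $P(U)$ is the congruence of the $(k+1)$-variable Laurent polynomial semiring $\mathbb{B}(t,\pmb x)$ generated by the pairs $(m_1+m_2,m_2)$, where $m_1,m_2$ are Laurent monomials with exponent vectors $\pmb n_1,\pmb n_2\in\mathbb{Z}^{k+1}$ (the first coordinate being the exponent of $t$) such that $U(\pmb n_2-\pmb n_1)=\pmb 0$ or the first non-zero coordinate of $U(\pmb n_2-\pmb n_1)$ is positive. It contains $(1+t,t)$, and $P(U)_{\mathbb{Z}}$ is the corresponding congruence of $\mathbb{Z}_{\max}(\pmb x)\cong\mathbb{B}(t,\pmb x)/\langle(1+t,t)\rangle$; $P[U]_{\mathbb{Z}}$ is the restriction of $P(U)_{\mathbb{Z}}$ to $\mathbb{Z}_{\max}[\pmb x]$. $\mathrm{Ker}(U)$ is the kernel of the linear map given by $U$. For $f=\sum_i t^{c_i}\pmb x^{\pmb n_i}$, $newt(f)\subseteq\mathbb{R}^{k+1}$ is the convex hull of the points $(c_i,\pmb n_i)\in\mathbb{Z}^{k+1}$ (and $newt(0)=\emptyset$); its hat is $\overline{newt(f)}=\{(y_0,\dots,y_k)\in newt(f)\mid \forall z>y_0:\ (z,y_1,\dots,y_k)\notin newt(f)\}$.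 *)

theory Defs
  imports "HOL-Analysis.Analysis" "HOL-Library.Poly_Mapping" "HOL-Library.Extended_Nat"
begin

section \<open>The semifields \<open>\<bool>\<close> and \<open>\<int>\<^sub>m\<^sub>a\<^sub>x\<close>\<close>

datatype boolean_semifield = BZero | BOne

instantiation boolean_semifield :: comm_semiring_1
begin

definition zero_boolean_semifield :: boolean_semifield where "0 = BZero"
definition one_boolean_semifield :: boolean_semifield where "1 = BOne"

fun plus_boolean_semifield :: "boolean_semifield \<Rightarrow> boolean_semifield \<Rightarrow> boolean_semifield" where
  "BZero + b = b"
| "BOne + b = BOne"

fun times_boolean_semifield :: "boolean_semifield \<Rightarrow> boolean_semifield \<Rightarrow> boolean_semifield" where
  "BZero * b = BZero"
| "BOne * b = b"

instance
proof
  fix a b c :: boolean_semifield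
  show "a + b + c = a + (b + c)" by (cases a; cases b; cases c) simp_all
  show "a + b = b + a" by (cases a; cases b) simp_all
  show "0 + a = a" by (simp add: zero_boolean_semifield_def)
  show "a * b * c = a * (b * c)" by (cases a; cases b; cases c) simp_all
  show "a * b = b * a" by (cases a; cases b) simp_all
  show "1 * a = a" by (simp add: one_boolean_semifield_def)
  show "(a + b) * c = a * c + b * c" by (cases a; cases b; cases c) simp_all
  show "0 * a = 0" by (simp add: zero_boolean_semifield_def)
  show "a * 0 = 0" by (cases a) (simp_all add: zero_boolean_semifield_def)
  show "(0 :: boolean_semifield) \<noteq> 1"
    by (simp add: zero_boolean_semifield_def one_boolean_semifield_def)
qed

end

text \<open>\<open>TPow c\<close> is the element written \<open>t\<^sup>c\<close>, and \<open>MinusInf\<close> is the additive identity.\<close>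

datatype zmax = MinusInf | TPow int

instantiation zmax :: comm_semiring_1
begin

definition zero_zmax :: zmax where "0 = MinusInf"
definition one_zmax :: zmax where "1 = TPow 0"

fun plus_zmax :: "zmax \<Rightarrow> zmax \<Rightarrow> zmax" where
  "MinusInf + b = b"
| "a + MinusInf = a"
| "TPow c + TPow d = TPow (max c d)"

fun times_zmax :: "zmax \<Rightarrow> zmax \<Rightarrow> zmax" where
  "MinusInf * b = MinusInf"
| "a * MinusInf = MinusInf"
| "TPow c * TPow d = TPow (c + d)"

instance
proof
  fix a b c :: zmax
  show "a + b + c = a + (b + c)" by (cases a; cases b; cases c) (simp_all add: max.assoc)
  show "a + b = b + a" by (cases a; cases b) (simp_all add: max.commute)
  show "0 + a = a" by (simp add: zero_zmax_def)
  show "a * b * c = a * (b * c)" by (cases a; cases b; cases c) simp_all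
  show "a * b = b * a" by (cases a; cases b) simp_all
  show "1 * a = a" by (cases a) (simp_all add: one_zmax_def)
  show "(a + b) * c = a * c + b * c"
    by (cases a; cases b; cases c) (simp_all add: max_add_distrib_left)
  show "0 * a = 0" by (simp add: zero_zmax_def)
  show "a * 0 = 0" by (cases a) (simp_all add: zero_zmax_def)
  show "(0 :: zmax) \<noteq> 1" by (simp add: zero_zmax_def one_zmax_def)
qed

end


section \<open>Congruences of a commutative semiring\<close>

definition semiring_congruence :: "('a::comm_semiring_1) rel \<Rightarrow> bool" where
  "semiring_congruence I \<longleftrightarrow> equiv UNIV I \<and>
     (\<forall>a b c d. (a, b) \<in> I \<longrightarrow> (c, d) \<in> I \<longrightarrow> (a + c, b + d) \<in> I \<and> (a * c, b * d) \<in> I)"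

definition generated_congruence :: "('a::comm_semiring_1) rel \<Rightarrow> 'a rel" where
  "generated_congruence S = \<Inter>{I. semiring_congruence I \<and> S \<subseteq> I}"

definition proper_congruence :: "('a::comm_semiring_1) rel \<Rightarrow> bool" where
  "proper_congruence I \<longleftrightarrow> semiring_congruence I \<and> I \<noteq> UNIV \<times> UNIV"

definition twisted_product :: "('a::comm_semiring_1) \<times> 'a \<Rightarrow> 'a \<times> 'a \<Rightarrow> 'a \<times> 'a" where
  "twisted_product \<alpha> \<beta> =
     (fst \<alpha> * fst \<beta> + snd \<alpha> * snd \<beta>, fst \<alpha> * snd \<beta> + snd \<alpha> * fst \<beta>)"

definition prime_congruence :: "('a::comm_semiring_1) rel \<Rightarrow> bool" where
  "prime_congruence P \<longleftrightarrow> proper_congruence P \<and>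
     (\<forall>\<alpha> \<beta>. twisted_product \<alpha> \<beta> \<in> P \<longrightarrow> \<alpha> \<in> P \<or> \<beta> \<in> P)"

definition minimal_prime_congruence :: "('a::comm_semiring_1) rel \<Rightarrow> bool" where
  "minimal_prime_congruence P \<longleftrightarrow> prime_congruence P \<and>
     (\<forall>Q. prime_congruence Q \<longrightarrow> Q \<subseteq> P \<longrightarrow> Q = P)"

definition congruence_dim :: "'a::comm_semiring_1 itself \<Rightarrow> enat" where
  "congruence_dim _ = Sup {enat n | n. \<exists>C :: nat \<Rightarrow> 'a rel.
     (\<forall>i\<le>n. prime_congruence (C i)) \<and> (\<forall>i<n. C i \<subset> C (Suc i))}"

definition congruence_Rad :: "('a::comm_semiring_1) rel \<Rightarrow> 'a rel" where
  "congruence_Rad I = \<Inter>{P. prime_congruence P \<and> I \<subseteq> P}"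

definition radical_congruence :: "('a::comm_semiring_1) rel \<Rightarrow> bool" where
  "radical_congruence I \<longleftrightarrow> semiring_congruence I \<and> congruence_Rad I = I"

text \<open>The class \<open>I `` {a}\<close> is the image of \<open>a\<close> in the quotient semiring by \<open>I\<close>, where
  products are computed on representatives.\<close>

definition QC_congruence :: "('a::comm_semiring_1) rel \<Rightarrow> bool" where
  "QC_congruence I \<longleftrightarrow> proper_congruence I \<and>
     (\<forall>a b c. I `` {a * b} = I `` {a * c} \<longrightarrow> I `` {a} = I `` {0} \<or> I `` {b} = I `` {c})"


section \<open>Polynomials and Laurent polynomials\<close>

text \<open>The variables are indexed by a finite type \<open>'k\<close>, so there are \<open>CARD('k)\<close> of them. In
  \<open>'k bool_laurent\<close> the additional first exponent is the one of \<open>t\<close>.\<close>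

type_synonym 'k zmax_poly = "(nat ^ 'k) \<Rightarrow>\<^sub>0 zmax"
type_synonym 'k zmax_laurent = "(int ^ 'k) \<Rightarrow>\<^sub>0 zmax"
type_synonym 'k bool_laurent = "(int \<times> (int ^ 'k)) \<Rightarrow>\<^sub>0 boolean_semifield"

definition laurent_of_poly :: "('k::finite) zmax_poly \<Rightarrow> 'k zmax_laurent" where
  "laurent_of_poly f =
     (\<Sum>n\<in>Poly_Mapping.keys f. Poly_Mapping.single (\<chi> i. int (n $ i)) (Poly_Mapping.lookup f n))"

text \<open>The surjective homomorphism that sends \<open>t\<^sup>c x\<^sup>n\<close> to the monomial \<open>x\<^sup>n\<close> with coefficient
  \<open>t\<^sup>c\<close>. Its kernel is the congruence generated by \<open>(1 + t, t)\<close>, so that it induces the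
  isomorphism of \<open>\<bool>(t,x) / \<langle>(1 + t, t)\<rangle>\<close> with \<open>\<int>\<^sub>m\<^sub>a\<^sub>x(x)\<close>.\<close>

definition zmax_of_bool_laurent :: "('k::finite) bool_laurent \<Rightarrow> 'k zmax_laurent" where
  "zmax_of_bool_laurent f =
     (\<Sum>(c, n)\<in>Poly_Mapping.keys f. Poly_Mapping.single n (TPow c))"


section \<open>Admissible matrices and their congruences\<close>

text \<open>A real matrix with \<open>CARD('k) + 1\<close> columns is the list of its rows; in each row the first
  component is the entry in the first column, the one that belongs to \<open>t\<close>.\<close>

type_synonym 'k real_matrix = "(real \<times> (real ^ 'k)) list"

definition real_exponent :: "int \<times> (int ^ 'k) \<Rightarrow> real \<times> (real ^ 'k)" where
  "real_exponent p = (of_int (fst p), \<chi> i. of_int (snd p $ i))"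

definition mat_apply :: "('k::finite) real_matrix \<Rightarrow> real \<times> (real ^ 'k) \<Rightarrow> real list" where
  "mat_apply U v = map (\<lambda>r. r \<bullet> v) U"

definition mat_Ker :: "('k::finite) real_matrix \<Rightarrow> (real \<times> (real ^ 'k)) set" where
  "mat_Ker U = {v. \<forall>y \<in> set (mat_apply U v). y = 0}"

definition first_nonzero_at :: "real list \<Rightarrow> nat \<Rightarrow> bool" where
  "first_nonzero_at v i \<longleftrightarrow> i < length v \<and> v ! i \<noteq> 0 \<and> (\<forall>j<i. v ! j = 0)"

definition zero_or_first_pos :: "real list \<Rightarrow> bool" where
  "zero_or_first_pos v \<longleftrightarrow> (\<forall>y \<in> set v. y = 0) \<or> (\<exists>i. first_nonzero_at v i \<and> v ! i > 0)"

definition admissible :: "('k::finite) real_matrix \<Rightarrow> bool" where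
  "admissible U \<longleftrightarrow>
     (\<forall>i<length U. \<exists>n. first_nonzero_at (mat_apply U (real_exponent n)) i)"

definition z_admissible :: "('k::finite) real_matrix \<Rightarrow> bool" where
  "z_admissible U \<longleftrightarrow> admissible U \<and> zero_or_first_pos (map fst U)"

definition P_cong :: "('k::finite) real_matrix \<Rightarrow> 'k bool_laurent rel" where
  "P_cong U = generated_congruence
     {(Poly_Mapping.single n1 1 + Poly_Mapping.single n2 1, Poly_Mapping.single n2 1) | n1 n2.
        zero_or_first_pos (mat_apply U (real_exponent (n2 - n1)))}"

definition P_cong_Z :: "('k::finite) real_matrix \<Rightarrow> 'k zmax_laurent rel" where
  "P_cong_Z U = map_prod zmax_of_bool_laurent zmax_of_bool_laurent ` P_cong U"

definition P_cong_poly_Z :: "('k::finite) real_matrix \<Rightarrow> 'k zmax_poly rel" where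
  "P_cong_poly_Z U = {(f, g). (laurent_of_poly f, laurent_of_poly g) \<in> P_cong_Z U}"


section \<open>Newton polytopes\<close>

definition newt :: "('k::finite) zmax_laurent \<Rightarrow> (real \<times> (real ^ 'k)) set" where
  "newt f = convex hull {real_exponent (c, n) | c n. Poly_Mapping.lookup f n = TPow c}"

definition newt_poly :: "('k::finite) zmax_poly \<Rightarrow> (real \<times> (real ^ 'k)) set" where
  "newt_poly f = newt (laurent_of_poly f)"

definition upper_hat :: "(real \<times> 'v) set \<Rightarrow> (real \<times> 'v) set" where
  "upper_hat N = {(y0, y). (y0, y) \<in> N \<and> (\<forall>z>y0. (z, y) \<notin> N)}"

end

theory Submission
  imports Defs
begin

text \<open>For a prime \<open>P\<close> the relation \<open>(f + g, g) \<in> P\<close> is a total preorder on the semiring, and every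
  nonzero polynomial is equivalent to one of its terms. The strict inequalities between terms
  modulo \<open>P\<close> span a semigroup of exponents in \<open>\<int>\<^sup>k\<^sup>+\<^sup>1\<close> without \<open>0\<close>; a total group order extending it
  defines a prime below \<open>P\<close>. So the minimal primes are the congruences of the total group orders with
  \<open>t > 1\<close>, and these orders are the lexicographic orders of matrices. Two polynomials agree modulo
  all of them iff the upper hulls of their Newton polytopes agree, because an integral semigroup
  without \<open>0\<close> does not have \<open>0\<close> in its convex hull (Dirichlet approximation turns a real convex
  combination into an integral one). The dimension is bounded by a transcendence-degree
  argument: along a strict inclusion of primes the largest number of independent generators drops.\<close>

section \<open>Semigroups of exponents\<close>

text \<open>Both semirings fit one picture: exponents are compared in the group Z^(k+1), and a
  polynomial is recorded by the set of group exponents that its terms dominate. The obstacle on the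
  polynomial side is that a prime may identify variables with 0. Strictness of an inequality between
  two terms then depends on the terms and not only on the difference of their exponents, and such a
  prime is not the congruence of a preorder on the group; it only lies above one. The dimension
  count has to tolerate vanishing generators too: independence excludes products equivalent to 0,
  and algebraic relations are written without denominators. In both semirings 1 + t = t gives only 1
  \<le> t modulo a prime, which may still identify t with 1. Strictness of 1 < t must therefore be
  imposed by hand before an order is extended.\<close>

definition nat_multiple :: "nat \<Rightarrow> 'g::comm_monoid_add \<Rightarrow> 'g" where
  "nat_multiple n v = (\<Sum>i<n. v)"

lemma nat_multiple_0 [simp]: "nat_multiple 0 v = 0"
  and nat_multiple_Suc [simp]: "nat_multiple (Suc n) v = v + nat_multiple n v"
  by (simp_all add: nat_multiple_def add.commute)

lemma nat_multiple_add: "nat_multiple (m + n) v = nat_multiple m v + nat_multiple n v"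
  by (induction m) (simp_all add: add.assoc)

lemma nat_multiple_uminus: "nat_multiple n (- v) = - nat_multiple n (v :: 'g::ab_group_add)"
  by (induction n) simp_all

lemma nat_multiple_mult: "nat_multiple (m * n) v = nat_multiple m (nat_multiple n v)"
  by (induction m) (simp_all add: nat_multiple_add)

lemma nat_multiple_closed:
  assumes "\<And>u v. u \<in> T \<Longrightarrow> v \<in> T \<Longrightarrow> u + v \<in> T" "v \<in> T" "n > 0"
  shows "nat_multiple n v \<in> T"
  using assms(3)
proof (induction n)
  case (Suc n)
  then show ?case using assms(1,2) by (cases "n = 0") auto
qed simp

text \<open>Zorn yields a maximal semigroup \<open>M\<close> without 0. If \<open>v\<close> lies
  outside \<open>M\<close>, adjoining it must produce 0, so a negative multiple of \<open>v\<close>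
  lies in \<open>M\<close>. If \<open>- v\<close> is outside as well, a positive multiple of
  \<open>v\<close> also lies in \<open>M\<close>, and suitable multiples of the two add up to
  0.\<close>

lemma total_semigroup_extension:
  fixes S :: "'g::ab_group_add set"
  assumes torsion_free: "\<And>(v::'g) n. n > 0 \<Longrightarrow> nat_multiple n v = 0 \<Longrightarrow> v = 0"
    and add_closed: "\<And>u v. u \<in> S \<Longrightarrow> v \<in> S \<Longrightarrow> u + v \<in> S"
    and zero: "0 \<notin> S"
  obtains T where "S \<subseteq> T" "\<And>u v. u \<in> T \<Longrightarrow> v \<in> T \<Longrightarrow> u + v \<in> T" "0 \<notin> T"
    "\<And>v. v \<noteq> 0 \<Longrightarrow> v \<in> T \<or> - v \<in> T"
proof -
  define F where "F = {T. S \<subseteq> T \<and> (\<forall>u\<in>T. \<forall>v\<in>T. u + v \<in> T) \<and> 0 \<notin> T}"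
  have "\<exists>M\<in>F. \<forall>X\<in>F. M \<subseteq> X \<longrightarrow> X = M"
  proof (rule subset_Zorn_nonempty)
    show "F \<noteq> {}" using add_closed zero by (auto simp: F_def)
    fix Ch assume "Ch \<noteq> {}" and ch: "subset.chain F Ch"
    then obtain X0 where X0: "X0 \<in> Ch" by blast
    have sub: "Ch \<subseteq> F" and lin: "\<And>X Y. X \<in> Ch \<Longrightarrow> Y \<in> Ch \<Longrightarrow> X \<subseteq> Y \<or> Y \<subseteq> X"
      using ch by (auto simp: subset.chain_def)
    have "u + v \<in> \<Union>Ch" if u: "u \<in> \<Union>Ch" and v: "v \<in> \<Union>Ch" for u v
    proof -
      obtain X Y where XY: "X \<in> Ch" "u \<in> X" "Y \<in> Ch" "v \<in> Y" using u v by blast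
      then obtain Z where "Z \<in> Ch" "u \<in> Z" "v \<in> Z" using lin[of X Y] by blast
      then show ?thesis using sub by (auto simp: F_def)
    qed
    moreover have "S \<subseteq> X0" using X0 sub by (auto simp: F_def)
    then have "S \<subseteq> \<Union>Ch" using X0 by blast
    moreover have "0 \<notin> \<Union>Ch" using sub by (auto simp: F_def)
    ultimately show "\<Union>Ch \<in> F" by (auto simp: F_def)
  qed
  then obtain M where M: "M \<in> F" and max: "\<And>X. X \<in> F \<Longrightarrow> M \<subseteq> X \<Longrightarrow> X = M" by blast
  have SM: "S \<subseteq> M" and Madd: "\<And>u v. u \<in> M \<Longrightarrow> v \<in> M \<Longrightarrow> u + v \<in> M" and M0: "0 \<notin> M"
    using M by (auto simp: F_def)
  have neg: "\<exists>m n. m \<in> M \<and> n > 0 \<and> m + nat_multiple n v = 0" if v: "v \<noteq> 0" "v \<notin> M" for v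
  proof -
    \<comment> \<open>The semigroup generated by \<open>M\<close> and \<open>v\<close>. The summand
      from \<open>M\<close> may be absent, and the last condition excludes the empty combination,
      which would be 0.\<close>
    define X where
      "X = {m + nat_multiple n v | m n. m \<in> insert 0 M \<and> (m \<in> M \<or> n > 0)}"
    have "a + b \<in> X" if a: "a \<in> X" and b: "b \<in> X" for a b
    proof -
      obtain m n where 1: "a = m + nat_multiple n v" "m \<in> insert 0 M" "m \<in> M \<or> n > 0"
        using a by (auto simp: X_def)
      obtain m' n' where 2: "b = m' + nat_multiple n' v" "m' \<in> insert 0 M" "m' \<in> M \<or> n' > 0"
        using b by (auto simp: X_def)
      have "a + b = (m + m') + nat_multiple (n + n') v"
        using 1 2 by (simp add: nat_multiple_add algebra_simps)
      moreover have "m + m' \<in> insert 0 M" "m + m' \<in> M \<or> n + n' > 0"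
        using 1 2 Madd by auto
      ultimately show ?thesis unfolding X_def by blast
    qed
    moreover have MX: "M \<subseteq> X"
    proof
      fix m assume "m \<in> M"
      then have "m = m + nat_multiple 0 v \<and> m \<in> insert 0 M \<and> (m \<in> M \<or> (0::nat) > 0)" by simp
      then show "m \<in> X" unfolding X_def by blast
    qed
    moreover have "v \<in> X"
      unfolding X_def by (intro CollectI exI[of _ 0] exI[of _ "1::nat"]) simp
    ultimately have "0 \<in> X" using max[of X] v(2) SM by (auto simp: F_def)
    then obtain m n where mn: "m + nat_multiple n v = 0" "m \<in> insert 0 M" "m \<in> M \<or> n > 0"
      by (auto simp: X_def)
    show ?thesis
    proof (cases "m \<in> M")
      case True
      then have "n > 0" using mn(1) M0 by (cases n) auto
      then show ?thesis using True mn(1) by blast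
    next
      case False
      then show ?thesis using mn torsion_free[of n v] v(1) by auto
    qed
  qed
  show ?thesis
  proof (rule that[OF SM Madd M0])
    fix v :: 'g assume v0: "v \<noteq> 0"
    show "v \<in> M \<or> - v \<in> M"
    proof (rule ccontr)
      assume "\<not> ?thesis"
      then obtain m n m' n' where
        1: "m \<in> M" "n > 0" "m + nat_multiple n v = 0" and
        2: "m' \<in> M" "n' > 0" "m' + nat_multiple n' (- v) = 0"
        using neg[of v] neg[of "- v"] v0 by auto
      have e: "m = nat_multiple n (- v)" "m' = nat_multiple n' v"
        using 1(3) 2(3) by (simp_all add: nat_multiple_uminus eq_neg_iff_add_eq_0)
      have "nat_multiple n' m + nat_multiple n m' = 0"
        by (simp add: e nat_multiple_mult[symmetric] nat_multiple_uminus mult.commute)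
      moreover have "nat_multiple n' m + nat_multiple n m' \<in> M"
        using 1 2 Madd by (intro Madd nat_multiple_closed) auto
      ultimately show False using M0 by simp
    qed
  qed auto
qed

section \<open>Integral exponents inside the real vector space\<close>

lemma real_exponent_0 [simp]: "real_exponent 0 = 0"
  by (simp add: real_exponent_def zero_prod_def vec_eq_iff)

lemma real_exponent_add: "real_exponent (v + w) = real_exponent v + real_exponent w"
  by (simp add: real_exponent_def plus_prod_def vec_eq_iff)

lemma real_exponent_uminus: "real_exponent (- v) = - real_exponent v"
  by (simp add: real_exponent_def uminus_prod_def vec_eq_iff)

lemma real_exponent_diff: "real_exponent (v - w) = real_exponent v - real_exponent w"
  by (simp add: real_exponent_def minus_prod_def vec_eq_iff)

lemma real_exponent_eq_0_iff [simp]: "real_exponent v = 0 \<longleftrightarrow> v = 0"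
  by (simp add: real_exponent_def zero_prod_def vec_eq_iff prod_eq_iff)

lemma real_exponent_nat_multiple:
  "real_exponent (nat_multiple n v) = real n *\<^sub>R real_exponent v"
  by (induction n) (simp_all add: real_exponent_add scaleR_left_distrib add.commute)

lemma real_exponent_sum: "real_exponent (sum f A) = (\<Sum>a\<in>A. real_exponent (f a))"
  by (induction A rule: infinite_finite_induct) (simp_all add: real_exponent_add)

lemma exponent_torsion_free:
  fixes v :: "int \<times> (int ^ 'k::finite)"
  assumes "n > 0" "nat_multiple n v = 0"
  shows "v = 0"
proof -
  have "real n *\<^sub>R real_exponent v = 0"
    using assms(2) real_exponent_nat_multiple[of n v] by simp
  then show ?thesis using assms(1) by simp
qed

text \<open>The coordinates are integers of absolute value below 1. This turns a small rounding
  error into an exact relation.\<close>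

lemma real_exponent_eq_0_if_norm_less_1:
  assumes "norm (real_exponent v) < 1"
  shows "v = 0"
proof -
  have "\<bar>of_int (fst v) :: real\<bar> < 1"
    using norm_fst_le[of "fst (real_exponent v)" "snd (real_exponent v)"] assms
    by (simp add: real_exponent_def)
  moreover have "\<bar>of_int (snd v $ i) :: real\<bar> < 1" for i
  proof -
    have "\<bar>of_int (snd v $ i) :: real\<bar> \<le> norm (snd (real_exponent v))"
      using component_le_norm_cart[of "snd (real_exponent v)" i] by (simp add: real_exponent_def)
    also have "\<dots> < 1"
      using norm_snd_le[of "snd (real_exponent v)" "fst (real_exponent v)"] assms by simp
    finally show ?thesis .
  qed
  ultimately have "fst v = 0" "\<And>i. snd v $ i = 0" by (simp_all flip: of_int_abs)
  then show ?thesis by (simp add: prod_eq_iff vec_eq_iff)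
qed

lemma zero_notin_convex_hull_semigroup:
  fixes T :: "(int \<times> (int ^ 'k::finite)) set"
  assumes add_closed: "\<And>u v. u \<in> T \<Longrightarrow> v \<in> T \<Longrightarrow> u + v \<in> T" and zero: "0 \<notin> T"
  shows "0 \<notin> convex hull (real_exponent ` T)"
proof
  assume "0 \<in> convex hull (real_exponent ` T)"
  then obtain R l where R: "finite R" "R \<subseteq> real_exponent ` T" and l: "\<And>x. x \<in> R \<Longrightarrow> 0 \<le> l x"
    and l1: "sum l R = 1" and l0: "(\<Sum>x\<in>R. l x *\<^sub>R x) = 0"
    by (auto simp: convex_hull_explicit)
  obtain g where g: "\<And>x. x \<in> R \<Longrightarrow> g x \<in> T \<and> real_exponent (g x) = x"
    using R(2) by (metis (no_types, opaque_lifting) image_iff subsetD)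
  obtain x0 where x0: "x0 \<in> R" "l x0 > 0"
    using l1 l by (metis sum_nonpos not_one_le_zero not_less)
  \<comment> \<open>\<open>N\<close> exceeds \<open>1 / l x0\<close> so that the rounded coefficient
    of \<open>x0\<close> stays positive, and exceeds the sum of the norms so that the total rounding
    error stays below 1.\<close>
  obtain N :: nat where N: "N > 0" "1 / l x0 < real N" "(\<Sum>x\<in>R. norm x) < real N"
  proof -
    obtain N :: nat where "max 1 (max (1 / l x0) (\<Sum>x\<in>R. norm x)) < real N"
      using reals_Archimedean2 by blast
    then show ?thesis using that[of N] by auto
  qed
  obtain h where h: "bij_betw h {..<card R} R"
    using ex_bij_betw_nat_finite[OF R(1)] by (auto simp: lessThan_atLeast0)
  obtain q p where q: "0 < q" and qp: "\<And>i. i < card R \<Longrightarrow> \<bar>of_int q * l (h i) - of_int (p i)\<bar> < 1 / N"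
    using Dirichlet_approx_simult[OF N(1), of "card R" "l \<circ> h"] by (metis comp_apply)
  define r where "r x = p (inv_into {..<card R} h x)" for x
  have r: "\<bar>of_int q * l x - of_int (r x)\<bar> < 1 / N" if "x \<in> R" for x
  proof -
    have "inv_into {..<card R} h x < card R" "h (inv_into {..<card R} h x) = x"
      using h that by (metis bij_betw_def inv_into_into lessThan_iff)
        (use h that in \<open>auto simp: bij_betw_def f_inv_into_f\<close>)
    then show ?thesis using qp[of "inv_into {..<card R} h x"] by (simp add: r_def)
  qed
  have inv_le: "1 / real N \<le> 1" using N(1) by simp
  have r_nonneg: "r x \<ge> 0" if "x \<in> R" for x
  proof -
    have "0 \<le> of_int q * l x" using q l[OF that] by simp
    then have "- 1 < (of_int (r x) :: real)" using r[OF that] inv_le by linarith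
    then show ?thesis by linarith
  qed
  have r_pos: "r x0 > 0"
  proof -
    have "1 / real N < l x0" using N x0 by (simp add: field_simps)
    moreover have "l x0 \<le> of_int q * l x0" using q x0(2) by simp
    ultimately have "0 < (of_int (r x0) :: real)" using r[OF x0(1)] by linarith
    then show ?thesis by simp
  qed
  define w where "w = (\<Sum>x\<in>R. nat_multiple (nat (r x)) (g x))"
  have "real_exponent w = (\<Sum>x\<in>R. of_int (r x) *\<^sub>R x)"
    unfolding w_def real_exponent_sum real_exponent_nat_multiple
    by (intro sum.cong) (use g r_nonneg in auto)
  \<comment> \<open>Subtracting \<open>q\<close> times the vanishing combination leaves the rounding
    errors as coefficients.\<close>
  also have "\<dots> = (\<Sum>x\<in>R. of_int (r x) *\<^sub>R x) - of_int q *\<^sub>R (\<Sum>x\<in>R. l x *\<^sub>R x)"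
    by (simp add: l0)
  also have "\<dots> = (\<Sum>x\<in>R. (of_int (r x) - of_int q * l x) *\<^sub>R x)"
    by (simp add: scaleR_sum_right sum_subtractf[symmetric] scaleR_left_diff_distrib)
  also have "norm \<dots> \<le> (\<Sum>x\<in>R. 1 / N * norm x)"
    by (intro sum_norm_le) (use r in \<open>simp add: abs_minus_commute less_imp_le mult_right_mono del: times_divide_eq_left\<close>)
  also have "\<dots> < 1"
    using N by (simp flip: sum_divide_distrib)
  finally have "w = 0" by (rule real_exponent_eq_0_if_norm_less_1)
  \<comment> \<open>Rounded coefficients may be 0, so partial sums are only known to lie in
    \<open>insert 0 T\<close>. The summand of \<open>x0\<close> is split off below because its
    positive coefficient puts the whole sum into \<open>T\<close> itself.\<close>
  have closed: "insert 0 T \<subseteq> Collect (\<lambda>v. \<forall>u \<in> insert 0 T. u + v \<in> insert 0 T)"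
    using add_closed by auto
  have "(\<Sum>x\<in>Q. nat_multiple (nat (r x)) (g x)) \<in> insert 0 T" if "Q \<subseteq> R" for Q
    using finite_subset[OF that R(1)] that
  proof (induction Q)
    case (insert x Q)
    have "nat_multiple (nat (r x)) (g x) \<in> insert 0 T"
      using nat_multiple_closed[OF add_closed, of "g x" "nat (r x)"] g insert.prems
      by (cases "nat (r x) = 0") auto
    then show ?case using insert closed by auto
  qed simp
  from this[of "R - {x0}"] have rest: "(\<Sum>x\<in>R - {x0}. nat_multiple (nat (r x)) (g x)) \<in> insert 0 T"
    (is "?rest \<in> _")
    by blast
  have x0T: "nat_multiple (nat (r x0)) (g x0) \<in> T"
    using nat_multiple_closed[OF add_closed, of "g x0" "nat (r x0)"] g x0 r_pos by auto
  have "w = nat_multiple (nat (r x0)) (g x0) + ?rest"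
    unfolding w_def by (rule sum.remove[OF R(1) x0(1)])
  moreover have "\<dots> \<in> T"
    using rest
  proof
    assume "?rest = 0"
    then show ?thesis using x0T by (simp only: add_0_right)
  qed (rule add_closed[OF x0T])
  ultimately have "w \<in> T" by (simp only:)
  then show False using \<open>w = 0\<close> zero by simp
qed

section \<open>Prime congruences of additively idempotent semirings\<close>

lemma congruence_refl: "semiring_congruence I \<Longrightarrow> (a, a) \<in> I"
  and congruence_sym: "semiring_congruence I \<Longrightarrow> (a, b) \<in> I \<Longrightarrow> (b, a) \<in> I"
  and congruence_trans: "semiring_congruence I \<Longrightarrow> (a, b) \<in> I \<Longrightarrow> (b, c) \<in> I \<Longrightarrow> (a, c) \<in> I"
  and congruence_add: "semiring_congruence I \<Longrightarrow> (a, b) \<in> I \<Longrightarrow> (c, d) \<in> I \<Longrightarrow> (a + c, b + d) \<in> I"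
  and congruence_mult: "semiring_congruence I \<Longrightarrow> (a, b) \<in> I \<Longrightarrow> (c, d) \<in> I \<Longrightarrow> (a * c, b * d) \<in> I"
  unfolding semiring_congruence_def
  by (auto simp: equiv_def refl_on_def dest: symD transD)

lemma congruence_power:
  "semiring_congruence I \<Longrightarrow> (a, b) \<in> I \<Longrightarrow> (a ^ n, b ^ n) \<in> I"
  by (induction n) (simp_all add: congruence_refl congruence_mult)

lemma congruence_class_eq_iff:
  "semiring_congruence I \<Longrightarrow> I `` {a} = I `` {b} \<longleftrightarrow> (a, b) \<in> I"
  unfolding semiring_congruence_def by (simp add: eq_equiv_class_iff[OF _ UNIV_I UNIV_I])

lemma semiring_congruence_Inter:
  assumes "\<And>I. I \<in> \<I> \<Longrightarrow> semiring_congruence I"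
  shows "semiring_congruence (\<Inter>\<I>)"
  unfolding semiring_congruence_def
proof (intro conjI equivI allI impI)
  show "sym (\<Inter>\<I>)"
    using assms by (blast intro: symI congruence_sym)
  show "trans (\<Inter>\<I>)"
    using assms by (blast intro: transI congruence_trans)
qed (use assms in \<open>auto simp: refl_on_def intro: congruence_refl congruence_add congruence_mult\<close>)

lemma prime_congruenceD:
  assumes "prime_congruence P"
  shows prime_imp_congruence: "semiring_congruence P"
    and prime_one_zero: "(1, 0) \<notin> P"
proof -
  show cong: "semiring_congruence P"
    using assms by (simp add: prime_congruence_def proper_congruence_def)
  show "(1, 0) \<notin> P"
  proof
    assume "(1, 0) \<in> P"
    then have "(a, 0) \<in> P" for a
      using congruence_mult[OF cong congruence_refl[OF cong, of a], of 1 0] by simp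
    then have "P = UNIV \<times> UNIV"
      by (auto intro: congruence_trans[OF cong] congruence_sym[OF cong])
    then show False using assms by (simp add: prime_congruence_def proper_congruence_def)
  qed
qed

text \<open>The case of primality in which one factor is \<open>(a, 0)\<close>. It takes the place
  of division in all later arguments.\<close>

lemma prime_cancel:
  assumes "prime_congruence P" "(a * b, a * c) \<in> P"
  shows "(a, 0) \<in> P \<or> (b, c) \<in> P"
proof -
  have "twisted_product (a, 0) (b, c) = (a * b, a * c)"
    by (simp add: twisted_product_def)
  then show ?thesis using assms unfolding prime_congruence_def by metis
qed

lemma prime_mult_zero:
  "prime_congruence P \<Longrightarrow> (a * b, 0) \<in> P \<Longrightarrow> (a, 0) \<in> P \<or> (b, 0) \<in> P"
  using prime_cancel[of P a b 0] by simp

lemma prime_power_zero: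
  assumes "prime_congruence P" "(a ^ n, 0) \<in> P"
  shows "(a, 0) \<in> P"
  using assms(2)
  by (induction n) (use assms(1) prime_one_zero[OF assms(1)] in \<open>auto dest: prime_mult_zero\<close>)

locale idempotent_prime =
  fixes P :: "('a::comm_semiring_1) rel"
  assumes prime: "prime_congruence P" and idem: "\<And>a::'a. a + a = a"
begin

lemmas cong = prime_imp_congruence[OF prime]
lemmas rf = congruence_refl[OF cong] and sy = congruence_sym[OF cong] and tr = congruence_trans[OF cong]
  and ad = congruence_add[OF cong] and mu = congruence_mult[OF cong]

text \<open>The natural order of the quotient, on representatives: addition is idempotent, hence a
  join.\<close>

definition le :: "'a \<Rightarrow> 'a \<Rightarrow> bool" where
  "le a b \<longleftrightarrow> (a + b, b) \<in> P"

lemma idem_left: "a + (a + b) = a + (b::'a)"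
  by (metis add.assoc idem)

lemma le_refl: "le a a" and le_zero: "le 0 a"
  by (simp_all add: le_def idem rf)

lemma le_antisym: "le a b \<Longrightarrow> le b a \<Longrightarrow> (a, b) \<in> P"
  unfolding le_def by (metis sy tr add.commute)

lemma eq_imp_le: "(a, b) \<in> P \<Longrightarrow> le a b"
  unfolding le_def using ad[OF _ rf, of a b b] by (simp add: idem)

lemma le_trans: "le a b \<Longrightarrow> le b c \<Longrightarrow> le a c"
proof -
  assume ab: "le a b" and bc: "le b c"
  have "(a + c, a + (b + c)) \<in> P" using ad[OF rf sy, of "b + c" c a] bc by (simp add: le_def)
  moreover have "((a + b) + c, b + c) \<in> P" using ab by (intro ad rf) (simp add: le_def)
  moreover have "(b + c, c) \<in> P" using bc by (simp add: le_def)
  ultimately show "le a c" unfolding le_def add.assoc by (meson tr)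
qed

lemma le_add: "le a c \<Longrightarrow> le b c \<Longrightarrow> le (a + b) c"
proof -
  assume a: "le a c" and b: "le b c"
  have "((a + c) + (b + c), c + c) \<in> P" using a b by (intro ad) (simp_all add: le_def)
  moreover have "(a + c) + (b + c) = a + b + c" by (metis add.assoc add.commute idem)
  ultimately show ?thesis by (simp add: le_def idem)
qed

lemma le_add_self: "le a (a + b)"
  by (simp add: le_def idem_left rf)

lemma le_sum: "finite A \<Longrightarrow> (\<And>i. i \<in> A \<Longrightarrow> le (f i) c) \<Longrightarrow> le (sum f A) c"
  by (induction A rule: finite_induct) (auto simp: le_zero intro: le_add)

lemma le_sum_member: "finite A \<Longrightarrow> i \<in> A \<Longrightarrow> le (f i) (sum f A)"
  by (simp add: sum.remove le_add_self)

lemma le_mult: "le a b \<Longrightarrow> le c d \<Longrightarrow> le (a * c) (b * d)"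
proof -
  assume a: "le a b" and b: "le c d"
  have "(a * c + b * c, b * c) \<in> P" using mu[OF _ rf[of c], of "a + b" b] a
    by (simp add: le_def distrib_right)
  moreover have "(b * c + b * d, b * d) \<in> P" using mu[OF rf[of b], of "c + d" d] b
    by (simp add: le_def distrib_left)
  ultimately show ?thesis using le_trans[of "a * c" "b * c" "b * d"] by (simp add: le_def)
qed

text \<open>By idempotency both components of the twisted product of \<open>(a + b, a)\<close> and
  \<open>(a + b, b)\<close> are a^2 + ab + b^2, so the join of \<open>a\<close> and \<open>b\<close>
  is equivalent to one of them.\<close>

lemma le_total: "le a b \<or> le b a"
proof -
  have "(a + b) * (a + b) + a * b = (a + b) * b + a * (a + b)"
    by (simp add: algebra_simps idem_left idem)
  then have "twisted_product (a + b, a) (a + b, b) \<in> P"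
    by (simp add: twisted_product_def rf)
  then have "(a + b, a) \<in> P \<or> (a + b, b) \<in> P"
    using prime unfolding prime_congruence_def by blast
  then show ?thesis by (auto simp: le_def add.commute)
qed

text \<open>Otherwise \<open>b * d\<close> \<le> \<open>a * c\<close> \<le> \<open>a * d\<close>
  \<le> \<open>b * d\<close>, and cancelling \<open>d\<close> makes \<open>a\<close> and
  \<open>b\<close> equivalent. Cancellation is possible because \<open>d\<close> is strictly above
  \<open>c\<close>, hence not equivalent to 0.\<close>

lemma strict_mult:
  assumes "\<not> le b a" "\<not> le d c"
  shows "\<not> le (b * d) (a * c)"
proof
  assume bd: "le (b * d) (a * c)"
  have ab: "le a b" and cd: "le c d" using assms le_total by blast+
  have "(d * a, d * b) \<in> P"
  proof (rule le_antisym)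
    show "le (d * a) (d * b)" by (intro le_mult le_refl ab)
    show "le (d * b) (d * a)"
      using le_trans[OF bd le_mult[OF le_refl cd]] by (simp add: mult.commute)
  qed
  then have "(d, 0) \<in> P \<or> (a, b) \<in> P" by (rule prime_cancel[OF prime])
  then show False using assms eq_imp_le le_zero le_trans sy by blast
qed

text \<open>A strict inequality between \<open>a\<close> and \<open>b\<close>, in either direction,
  would persist for positive powers.\<close>

lemma power_cancel:
  assumes "n > 0" "(a ^ n, b ^ n) \<in> P"
  shows "(a, b) \<in> P"
proof -
  have strict: "\<not> le (b ^ n) (a ^ n)" if "\<not> le b a" "n > 0" for a b n
    using that(2)
  proof (induction n)
    case (Suc n)
    then show ?case using strict_mult[OF that(1), of "b ^ n" "a ^ n"] that(1)
      by (cases "n = 0") auto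
  qed simp
  show ?thesis
    using strict[of a b n] strict[of b a n] assms eq_imp_le sy le_antisym by blast
qed

lemma sum_equiv_summand:
  assumes "finite A" "A \<noteq> {}"
  shows "\<exists>i\<in>A. (sum f A, f i) \<in> P"
  using assms
proof (induction A rule: finite_ne_induct)
  case (insert x A)
  then obtain i where i: "i \<in> A" "(sum f A, f i) \<in> P" by blast
  have s: "sum f (insert x A) = f x + sum f A" using insert by simp
  show ?case
  proof (cases "le (f x) (sum f A)")
    case True
    then show ?thesis unfolding s using i by (auto simp: le_def intro: tr)
  next
    case False
    then have "le (sum f A) (f x)" using le_total by blast
    then show ?thesis unfolding s by (auto simp: le_def add.commute)
  qed
qed (simp add: rf)

end

section \<open>Chains of prime congruences\<close>

definition power_product :: "('i::finite \<Rightarrow> 'a::comm_semiring_1) \<Rightarrow> ('i \<Rightarrow> nat) \<Rightarrow> 'a" where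
  "power_product X e = (\<Prod>i\<in>UNIV. X i ^ e i)"

lemma power_product_0: "power_product X (\<lambda>_. 0) = 1"
  and power_product_add: "power_product X (\<lambda>i. d i + e i) = power_product X d * power_product X e"
  and power_product_mult: "power_product X (\<lambda>i. n * e i) = power_product X e ^ n"
  by (simp_all add: power_product_def power_add prod.distrib prod_power_distrib mult.commute[of n]
      flip: power_mult)

text \<open>The counterpart of algebraic independence. Only relations between monomials are
  considered, since modulo a prime a sum is equivalent to one of its summands. Products equivalent
  to 0 are excluded separately because generators may vanish modulo a prime.\<close>

definition independent_mod :: "('a::comm_semiring_1) rel \<Rightarrow> ('i::finite \<Rightarrow> 'a) \<Rightarrow> 'i set \<Rightarrow> bool" where
  "independent_mod P X T \<longleftrightarrow>
     (\<forall>d. (\<forall>i. i \<notin> T \<longrightarrow> d i = 0) \<longrightarrow> (power_product X d, 0) \<notin> P) \<and>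
     (\<forall>d e. (\<forall>i. i \<notin> T \<longrightarrow> d i = 0) \<longrightarrow> (\<forall>i. i \<notin> T \<longrightarrow> e i = 0) \<longrightarrow>
        (power_product X d, power_product X e) \<in> P \<longrightarrow> d = e)"

text \<open>The counterpart of the transcendence degree, within a fixed finite family
  \<open>X\<close>.\<close>

definition congruence_rank :: "('a::comm_semiring_1) rel \<Rightarrow> ('i::finite \<Rightarrow> 'a) \<Rightarrow> nat" where
  "congruence_rank P X = Max (card ` Collect (independent_mod P X))"

lemma congruence_rank_ge: "independent_mod P X T \<Longrightarrow> card T \<le> congruence_rank P X"
  by (simp add: congruence_rank_def)

lemma independent_mod_mono: "P \<subseteq> Q \<Longrightarrow> independent_mod Q X T \<Longrightarrow> independent_mod P X T"
  unfolding independent_mod_def by (meson subsetD)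

lemma congruence_rank_attained:
  fixes X :: "'i::finite \<Rightarrow> 'a::comm_semiring_1"
  assumes "prime_congruence P"
  obtains T where "independent_mod P X T" "card T = congruence_rank P X"
proof -
  have "(\<forall>i. i \<notin> ({} :: 'i set) \<longrightarrow> d i = 0) \<longleftrightarrow> d = (\<lambda>_. 0)" for d :: "'i \<Rightarrow> nat"
    by (simp add: fun_eq_iff)
  then have "independent_mod P X {}"
    using prime_one_zero[OF assms] by (simp add: independent_mod_def power_product_0)
  then have "congruence_rank P X \<in> card ` Collect (independent_mod P X)"
    unfolding congruence_rank_def by (intro Max_in) auto
  then show ?thesis using that by auto
qed

lemma congruence_rank_le_CARD:
  fixes X :: "'i::finite \<Rightarrow> 'a::comm_semiring_1"
  assumes "prime_congruence P"
  shows "congruence_rank P X \<le> CARD('i)"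
  using congruence_rank_attained[OF assms, of X] by (metis card_mono finite subset_UNIV)

definition algebraic_mod ::
    "('a::comm_semiring_1) rel \<Rightarrow> ('i::finite \<Rightarrow> 'a) \<Rightarrow> 'i set \<Rightarrow> 'a \<Rightarrow> bool" where
  "algebraic_mod P X T a \<longleftrightarrow> (a, 0) \<in> P \<or>
     (\<exists>n d e. n > 0 \<and> (\<forall>i. i \<notin> T \<longrightarrow> d i = 0) \<and> (\<forall>i. i \<notin> T \<longrightarrow> e i = 0) \<and>
        (a ^ n * power_product X d, power_product X e) \<in> P)"

context idempotent_prime begin

text \<open>A dependence on \<open>insert j T\<close> either makes a product vanish, which forces
  \<open>X j\<close> to vanish, or relates two monomials. In the second case the smaller power of
  \<open>X j\<close> cancels, and a positive power of \<open>X j\<close> must remain, as otherwise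
  \<open>T\<close> would be dependent.\<close>

lemma algebraic_generator:
  assumes T: "independent_mod P X T" and Tj: "\<not> independent_mod P X (insert j T)"
  shows "algebraic_mod P X T (X j)"
proof -
  have split: "power_product X d = X j ^ d j * power_product X (d(j := 0))" for d
    unfolding power_product_def
    by (subst (1 2) prod.remove[of UNIV j]) (auto intro!: prod.cong)
  consider d where "\<And>i. i \<notin> insert j T \<Longrightarrow> d i = 0" "(power_product X d, 0) \<in> P"
    | d e where "\<And>i. i \<notin> insert j T \<Longrightarrow> d i = 0" "\<And>i. i \<notin> insert j T \<Longrightarrow> e i = 0"
      "(power_product X d, power_product X e) \<in> P" "d \<noteq> e" "e j \<le> d j"
    using Tj unfolding independent_mod_def by (metis nat_le_linear sy)
  then show ?thesis
  proof cases
    case 1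
    then have "(X j ^ d j, 0) \<in> P \<or> (power_product X (d(j := 0)), 0) \<in> P"
      using prime_mult_zero[OF prime] split by metis
    moreover have "(power_product X (d(j := 0)), 0) \<notin> P"
      using T 1(1) unfolding independent_mod_def by auto
    ultimately show ?thesis
      using prime_power_zero[OF prime] by (auto simp: algebraic_mod_def)
  next
    case 2
    have pw: "X j ^ d j = X j ^ e j * X j ^ (d j - e j)" using 2(5) by (simp flip: power_add)
    have "(X j ^ e j * (X j ^ (d j - e j) * power_product X (d(j := 0))),
           X j ^ e j * power_product X (e(j := 0))) \<in> P"
      using 2(3) by (simp add: split[of d] split[of e] pw mult.assoc)
    then consider "(X j ^ e j, 0) \<in> P"
      | "(X j ^ (d j - e j) * power_product X (d(j := 0)), power_product X (e(j := 0))) \<in> P"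
      using prime_cancel[OF prime] by blast
    then show ?thesis
    proof cases
      case 1
      then show ?thesis using prime_power_zero[OF prime] by (auto simp: algebraic_mod_def)
    next
      case b: 2
      show ?thesis
      proof (cases "d j = e j")
        case True
        then have "d(j := 0) = e(j := 0)"
          using T b 2(1,2) unfolding independent_mod_def by auto
        then have "d = e" using True by (metis fun_upd_triv fun_upd_upd)
        then show ?thesis using 2 by simp
      next
        case False
        then show ?thesis unfolding algebraic_mod_def
          using b 2
          by (intro disjI2 exI[of _ "d j - e j"] exI[of _ "d(j := 0)"] exI[of _ "e(j := 0)"]) auto
      qed
    qed
  qed
qed

lemma algebraic_mult:
  assumes "algebraic_mod P X T a" "algebraic_mod P X T b"
  shows "algebraic_mod P X T (a * b)"
proof (cases "(a, 0) \<in> P \<or> (b, 0) \<in> P")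
  case True
  then have "(a * b, 0) \<in> P" using mu[OF _ rf, of a 0 b] mu[OF rf, of b 0 a] by auto
  then show ?thesis by (simp add: algebraic_mod_def)
next
  case False
  then obtain m d e n d' e' where
    1: "m > 0" "\<And>i. i \<notin> T \<Longrightarrow> d i = 0" "\<And>i. i \<notin> T \<Longrightarrow> e i = 0"
      "(a ^ m * power_product X d, power_product X e) \<in> P" and
    2: "n > 0" "\<And>i. i \<notin> T \<Longrightarrow> d' i = 0" "\<And>i. i \<notin> T \<Longrightarrow> e' i = 0"
      "(b ^ n * power_product X d', power_product X e') \<in> P"
    using assms unfolding algebraic_mod_def by metis
  have "((a ^ m * power_product X d) ^ n * (b ^ n * power_product X d') ^ m,
         power_product X e ^ n * power_product X e' ^ m) \<in> P"
    by (intro mu congruence_power[OF cong] 1 2)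
  moreover have "(a ^ m * power_product X d) ^ n * (b ^ n * power_product X d') ^ m
      = (a * b) ^ (m * n) * power_product X (\<lambda>i. n * d i + m * d' i)"
    by (simp add: power_product_add power_product_mult power_mult_distrib power_mult[symmetric] ac_simps)
  moreover have "power_product X e ^ n * power_product X e' ^ m = power_product X (\<lambda>i. n * e i + m * e' i)"
    by (simp add: power_product_add power_product_mult)
  ultimately show ?thesis using 1 2 unfolding algebraic_mod_def
    by (intro disjI2 exI[of _ "m * n"] exI[of _ "\<lambda>i. n * d i + m * d' i"]
        exI[of _ "\<lambda>i. n * e i + m * e' i"]) auto
qed

lemma algebraic_one: "algebraic_mod P X T 1"
  unfolding algebraic_mod_def
  by (intro disjI2 exI[of _ 1] exI[of _ "\<lambda>_. 0"]) (simp add: rf)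

lemma algebraic_power: "algebraic_mod P X T a \<Longrightarrow> algebraic_mod P X T (a ^ n)"
  by (induction n) (simp_all add: algebraic_one algebraic_mult)

lemma algebraic_power_product:
  assumes "\<And>j. algebraic_mod P X T (X j)"
  shows "algebraic_mod P X T (power_product X d)"
proof -
  have "algebraic_mod P X T (\<Prod>i\<in>A. X i ^ d i)" for A
    by (induction A rule: infinite_finite_induct)
      (simp_all add: algebraic_one algebraic_mult algebraic_power assms)
  then show ?thesis by (simp add: power_product_def)
qed

text \<open>Elements are reached from the generators only as quotients of products, so closure under
  exact division is required. Both relations are raised to powers in which \<open>b\<close> has the
  same exponent, and then \<open>b\<close> is eliminated.\<close>

lemma algebraic_division:
  assumes b: "algebraic_mod P X T b" "(b, 0) \<notin> P" and c: "algebraic_mod P X T (a * b)"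
  shows "algebraic_mod P X T a"
proof (cases "(a, 0) \<in> P")
  case True
  then show ?thesis by (simp add: algebraic_mod_def)
next
  case False
  then have "(a * b, 0) \<notin> P" using b(2) prime_mult_zero[OF prime] by blast
  then obtain m d e n d' e' where
    1: "m > 0" "\<And>i. i \<notin> T \<Longrightarrow> d i = 0" "\<And>i. i \<notin> T \<Longrightarrow> e i = 0"
      "((a * b) ^ m * power_product X d, power_product X e) \<in> P" and
    2: "n > 0" "\<And>i. i \<notin> T \<Longrightarrow> d' i = 0" "\<And>i. i \<notin> T \<Longrightarrow> e' i = 0"
      "(b ^ n * power_product X d', power_product X e') \<in> P"
    using b c unfolding algebraic_mod_def by metis
  \<comment> \<open>\<open>?u\<close> is evaluated twice: through the relation for
    \<open>a * b\<close> it is a monomial in \<open>T\<close>, through the relation for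
    \<open>b\<close> it is \<open>a ^ (m * n)\<close> times such a monomial.\<close>
  let ?u = "a ^ (m * n) * b ^ (m * n) * power_product X (\<lambda>i. n * d i + m * d' i)"
  have "(((a * b) ^ m * power_product X d) ^ n * power_product X d' ^ m,
         power_product X e ^ n * power_product X d' ^ m) \<in> P"
    by (intro mu congruence_power[OF cong] 1 rf)
  moreover have "((a * b) ^ m * power_product X d) ^ n * power_product X d' ^ m = ?u"
    by (simp add: power_product_add power_product_mult power_mult_distrib power_mult[symmetric] ac_simps)
  moreover have "power_product X e ^ n * power_product X d' ^ m = power_product X (\<lambda>i. n * e i + m * d' i)"
    by (simp add: power_product_add power_product_mult)
  ultimately have u: "(?u, power_product X (\<lambda>i. n * e i + m * d' i)) \<in> P" by simp
  have "(a ^ (m * n) * (b ^ n * power_product X d') ^ m * power_product X d ^ n,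
         a ^ (m * n) * power_product X e' ^ m * power_product X d ^ n) \<in> P"
    by (intro mu congruence_power[OF cong] 2 rf)
  moreover have "a ^ (m * n) * (b ^ n * power_product X d') ^ m * power_product X d ^ n = ?u"
    by (simp add: power_product_add power_product_mult power_mult_distrib power_mult[symmetric] ac_simps)
  moreover have "a ^ (m * n) * power_product X e' ^ m * power_product X d ^ n
      = a ^ (m * n) * power_product X (\<lambda>i. m * e' i + n * d i)"
    by (simp add: power_product_add power_product_mult ac_simps)
  ultimately have "(?u, a ^ (m * n) * power_product X (\<lambda>i. m * e' i + n * d i)) \<in> P"
    by (simp only:)
  then have "(a ^ (m * n) * power_product X (\<lambda>i. m * e' i + n * d i),
      power_product X (\<lambda>i. n * e i + m * d' i)) \<in> P"
    by (rule tr[OF sy u])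
  then show ?thesis using 1 2 unfolding algebraic_mod_def
    by (intro disjI2 exI[of _ "m * n"] exI[of _ "\<lambda>i. m * e' i + n * d i"]
        exI[of _ "\<lambda>i. n * e i + m * d' i"]) auto
qed

end

text \<open>Modulo every prime a nonvanishing element is a quotient of products of generators. The
  inverse \<open>w\<close> guarantees that the denominator vanishes modulo no prime.\<close>

definition prime_generating :: "('i::finite \<Rightarrow> 'a::comm_semiring_1) \<Rightarrow> bool" where
  "prime_generating X \<longleftrightarrow> (\<forall>P a. prime_congruence P \<longrightarrow> (a, 0) \<in> P \<or>
     (\<exists>u d e w. (a, u) \<in> P \<and> u * power_product X d = power_product X e \<and> power_product X d * w = 1))"

text \<open>A largest set \<open>T\<close> independent modulo \<open>Q\<close> is independent modulo
  \<open>P\<close>. If it could not be enlarged there, every element would be algebraic over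
  \<open>T\<close> modulo \<open>P\<close>. A relation in \<open>Q\<close> would then reduce to one
  between monomials in \<open>T\<close>, which is trivial by independence, so the relation would
  already hold in \<open>P\<close>.\<close>

lemma congruence_rank_strict_antimono:
  fixes X :: "'i::finite \<Rightarrow> 'a::comm_semiring_1"
  assumes idem: "\<And>a::'a. a + a = a" and gen: "prime_generating X"
    and P: "prime_congruence P" and Q: "prime_congruence Q" and PQ: "P \<subset> Q"
  shows "congruence_rank Q X < congruence_rank P X"
proof -
  interpret P: idempotent_prime P by unfold_locales (fact P idem)+
  interpret Q: idempotent_prime Q by unfold_locales (fact Q idem)+
  obtain T where T: "independent_mod Q X T" and cT: "card T = congruence_rank Q X"
    using congruence_rank_attained[OF Q] by blast
  have TP: "independent_mod P X T" using T PQ independent_mod_mono by blast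
  have "\<exists>j. j \<notin> T \<and> independent_mod P X (insert j T)"
  proof (rule ccontr)
    assume no: "\<not> ?thesis"
    have alg_gen: "algebraic_mod P X T (X j)" for j
    proof (cases "j \<in> T")
      case True
      let ?d = "\<lambda>i. if i = j then 1 else 0 :: nat"
      have "power_product X ?d = X j"
        unfolding power_product_def by (subst prod.remove[of UNIV j]) auto
      then have "(X j ^ 1 * power_product X (\<lambda>_. 0), power_product X ?d) \<in> P"
        by (simp add: power_product_0 P.rf)
      then show ?thesis using True unfolding algebraic_mod_def
        by (intro disjI2 exI[of _ 1] exI[of _ "\<lambda>_. 0"] exI[of _ ?d]) auto
    next
      case False
      then show ?thesis using no P.algebraic_generator[OF TP] by blast
    qed
    have alg: "algebraic_mod P X T a" for a
    proof (cases "(a, 0) \<in> P")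
      case True
      then show ?thesis by (simp add: algebraic_mod_def)
    next
      case False
      then obtain u d e w where u: "(a, u) \<in> P" "u * power_product X d = power_product X e"
        and w: "power_product X d * w = 1"
        using gen P unfolding prime_generating_def by blast
      have "(power_product X d, 0) \<notin> P"
        using P.mu[OF _ P.rf, of "power_product X d" 0 w] prime_one_zero[OF P] w by auto
      then have "algebraic_mod P X T u"
        using P.algebraic_division[of X T "power_product X d" u] P.algebraic_power_product[OF alg_gen] u(2)
        by simp
      moreover have "(u, 0) \<notin> P" using False u(1) P.tr by blast
      ultimately obtain n d e where n: "n > 0" "\<forall>i. i \<notin> T \<longrightarrow> d i = 0" "\<forall>i. i \<notin> T \<longrightarrow> e i = 0"
        "(u ^ n * power_product X d, power_product X e) \<in> P"
        unfolding algebraic_mod_def by blast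
      have "(a ^ n * power_product X d, u ^ n * power_product X d) \<in> P"
        using u(1) by (intro P.mu congruence_power[OF P.cong] P.rf)
      then have "(a ^ n * power_product X d, power_product X e) \<in> P" using n(4) P.tr by blast
      then show ?thesis unfolding algebraic_mod_def using n(1-3) by blast
    qed
    \<comment> \<open>\<open>Q\<close> annihilates nothing new: otherwise the algebraic relation for
      \<open>a\<close> would make a monomial in \<open>T\<close> vanish modulo
      \<open>Q\<close>.\<close>
    have zero: "(a, 0) \<in> P" if "(a, 0) \<in> Q" for a
    proof (rule ccontr)
      assume "(a, 0) \<notin> P"
      then obtain n d e where n: "n > 0" "\<forall>i. i \<notin> T \<longrightarrow> d i = 0" "\<forall>i. i \<notin> T \<longrightarrow> e i = 0"
        "(a ^ n * power_product X d, power_product X e) \<in> P"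
        using alg[of a] unfolding algebraic_mod_def by blast
      have "(a ^ n * power_product X d, 0 ^ n * power_product X d) \<in> Q"
        using that by (intro Q.mu congruence_power[OF Q.cong] Q.rf)
      then have "(power_product X e, 0) \<in> Q"
        using n(1,4) PQ Q.sy Q.tr by (metis mult_zero_left psubset_imp_subset subsetD zero_power)
      then show False using T n(3) unfolding independent_mod_def by blast
    qed
    have "(a, b) \<in> P" if ab: "(a, b) \<in> Q" for a b
    proof (cases "(a, 0) \<in> P \<or> (b, 0) \<in> P")
      case True
      then have "(a, 0) \<in> Q \<and> (b, 0) \<in> Q" using ab PQ Q.sy Q.tr by blast
      then show ?thesis using zero P.sy P.tr by blast
    next
      case False
      then obtain m d e n d' e' where
        1: "m > 0" "\<And>i. i \<notin> T \<Longrightarrow> d i = 0" "\<And>i. i \<notin> T \<Longrightarrow> e i = 0"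
          "(a ^ m * power_product X d, power_product X e) \<in> P" and
        2: "n > 0" "\<And>i. i \<notin> T \<Longrightarrow> d' i = 0" "\<And>i. i \<notin> T \<Longrightarrow> e' i = 0"
          "(b ^ n * power_product X d', power_product X e') \<in> P"
        using alg[of a] alg[of b] unfolding algebraic_mod_def by metis
      \<comment> \<open>A common denominator: multiplied by it, both \<open>a ^ (m * n)\<close> and
        \<open>b ^ (m * n)\<close> become monomials in \<open>T\<close> modulo
        \<open>P\<close>.\<close>
      let ?D = "power_product X (\<lambda>i. n * d i + m * d' i)"
      let ?E = "\<lambda>i. n * e i + m * d' i" and ?E' = "\<lambda>i. m * e' i + n * d i"
      have "((a ^ m * power_product X d) ^ n * power_product X d' ^ m,
         power_product X e ^ n * power_product X d' ^ m) \<in> P"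
        by (intro P.mu congruence_power[OF P.cong] 1 P.rf)
      moreover have "(a ^ m * power_product X d) ^ n * power_product X d' ^ m = ?D * a ^ (m * n)"
        by (simp add: power_product_add power_product_mult power_mult_distrib power_mult[symmetric] ac_simps)
      ultimately have aE: "(?D * a ^ (m * n), power_product X ?E) \<in> P"
        by (simp add: power_product_add power_product_mult)
      have "((b ^ n * power_product X d') ^ m * power_product X d ^ n,
         power_product X e' ^ m * power_product X d ^ n) \<in> P"
        by (intro P.mu congruence_power[OF P.cong] 2 P.rf)
      moreover have "(b ^ n * power_product X d') ^ m * power_product X d ^ n = ?D * b ^ (m * n)"
        by (simp add: power_product_add power_product_mult power_mult_distrib power_mult[symmetric] ac_simps)
      ultimately have bE: "(?D * b ^ (m * n), power_product X ?E') \<in> P"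
        by (simp add: power_product_add power_product_mult)
      have "(?D * a ^ (m * n), ?D * b ^ (m * n)) \<in> Q"
        using ab by (intro Q.mu congruence_power[OF Q.cong] Q.rf)
      then have "(power_product X ?E, power_product X ?E') \<in> Q"
        using aE bE PQ Q.sy Q.tr by (meson psubset_imp_subset subsetD)
      then have eq: "?E = ?E'"
        using T 1 2 unfolding independent_mod_def by (auto 0 0)
      have "(?D * a ^ (m * n), ?D * b ^ (m * n)) \<in> P"
        by (rule P.tr[OF aE P.sy[OF bE[folded eq]]])
      moreover have "(?D, 0) \<notin> P"
        using TP 1 2 unfolding independent_mod_def by auto
      ultimately have "(a ^ (m * n), b ^ (m * n)) \<in> P"
        using prime_cancel[OF P] by blast
      then show ?thesis using P.power_cancel[of "m * n"] 1(1) 2(1) by simp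
    qed
    then show False using PQ by auto
  qed
  then obtain j where "j \<notin> T" "independent_mod P X (insert j T)" by blast
  then show ?thesis using congruence_rank_ge[of P X "insert j T"] cT by simp
qed

lemma prime_chain_length_le:
  fixes X :: "'i::finite \<Rightarrow> 'a::comm_semiring_1"
  assumes idem: "\<And>a::'a. a + a = a" and gen: "prime_generating X"
    and C: "\<And>i. i \<le> n \<Longrightarrow> prime_congruence (C i :: 'a rel)" "\<And>i. i < n \<Longrightarrow> C i \<subset> C (Suc i)"
  shows "n \<le> CARD('i)"
proof -
  have "congruence_rank (C i) X + i \<le> CARD('i)" if "i \<le> n" for i
    using that
  proof (induction i)
    case 0
    then show ?case using congruence_rank_le_CARD[OF C(1)[of 0], of X] by simp
  next
    case (Suc i)
    then have "congruence_rank (C (Suc i)) X < congruence_rank (C i) X"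
      by (intro congruence_rank_strict_antimono[OF idem gen] C) auto
    then show ?case using Suc by simp
  qed
  from this[of n] show ?thesis by simp
qed

section \<open>Cones of total preorders on the exponents\<close>

text \<open>The exponents v \<ge> 0 of a translation-invariant total preorder. The last condition
  says 1 \<le> t, as forced by 1 + t = t.\<close>

definition total_cone :: "(int \<times> (int ^ 'k::finite)) set \<Rightarrow> bool" where
  "total_cone C \<longleftrightarrow> (\<forall>u\<in>C. \<forall>v\<in>C. u + v \<in> C) \<and> (\<forall>v. v \<in> C \<or> - v \<in> C) \<and> (1, 0) \<in> C"

definition order_cone :: "(int \<times> (int ^ 'k::finite)) set \<Rightarrow> bool" where
  "order_cone C \<longleftrightarrow> total_cone C \<and> (\<forall>v\<in>C. - v \<in> C \<longrightarrow> v = 0)"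

lemma order_imp_total_cone: "order_cone C \<Longrightarrow> total_cone C"
  by (simp add: order_cone_def)

lemma order_cone_antisym: "order_cone C \<Longrightarrow> v \<in> C \<Longrightarrow> - v \<in> C \<Longrightarrow> v = 0"
  by (simp add: order_cone_def)

lemma total_cone_add: "total_cone C \<Longrightarrow> u \<in> C \<Longrightarrow> v \<in> C \<Longrightarrow> u + v \<in> C"
  and total_cone_total: "total_cone C \<Longrightarrow> v \<notin> C \<Longrightarrow> - v \<in> C"
  and total_cone_t: "total_cone C \<Longrightarrow> (1, 0) \<in> C"
  unfolding total_cone_def by blast+

lemma total_cone_zero: "total_cone C \<Longrightarrow> 0 \<in> C"
  using total_cone_total[of C 0] by auto

lemma total_cone_t_power:
  assumes "total_cone C" "n \<ge> 0"
  shows "(n, 0) \<in> C"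
  using assms(2)
proof (induction n rule: int_ge_induct)
  case base
  then show ?case using total_cone_zero[OF assms(1)] by (simp add: zero_prod_def)
next
  case (step i)
  then show ?case using total_cone_add[OF assms(1) _ total_cone_t[OF assms(1)], of "(i, 0)"] by simp
qed

lemma order_cone_positive_add:
  assumes C: "order_cone C" and u: "u \<in> C - {0}" and v: "v \<in> C - {0}"
  shows "u + v \<in> C - {0}"
proof -
  have "u + v \<noteq> 0"
  proof
    assume "u + v = 0"
    then have "- u = v" by (simp add: eq_neg_iff_add_eq_0 minus_unique)
    then show False using order_cone_antisym[OF C, of u] u v by auto
  qed
  then show ?thesis using u v total_cone_add[OF order_imp_total_cone[OF C]] by blast
qed

text \<open>An exponent \<open>w\<close> below \<open>a + b\<close> splits as \<open>a\<close> plus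
  \<open>w - a\<close>. The second summand is in general only an element of the group, which is why
  dominated exponents are taken in Z^(k+1) even for polynomials.\<close>

lemma total_cone_lower_sum:
  assumes C: "total_cone C"
  shows "{w. \<exists>a\<in>A. \<exists>b\<in>B. a + b - w \<in> C}
    = {u + v | u v. u \<in> {u. \<exists>a\<in>A. a - u \<in> C} \<and> v \<in> {v. \<exists>b\<in>B. b - v \<in> C}}" (is "?L = ?R")
proof (intro equalityI subsetI)
  fix w assume "w \<in> ?L"
  then obtain a b where ab: "a \<in> A" "b \<in> B" "a + b - w \<in> C" by blast
  have "b - (w - a) = a + b - w" by (simp add: algebra_simps)
  then have "\<exists>b\<in>B. b - (w - a) \<in> C" using ab by metis
  moreover have "\<exists>b\<in>A. b - a \<in> C" using ab(1) total_cone_zero[OF C] by force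
  moreover have "w = a + (w - a)" by simp
  ultimately show "w \<in> ?R" by blast
next
  fix w assume "w \<in> ?R"
  then obtain u v a b where w: "w = u + v" and ab: "a \<in> A" "a - u \<in> C" "b \<in> B" "b - v \<in> C" by blast
  have "(a - u) + (b - v) \<in> C" by (rule total_cone_add[OF C ab(2,4)])
  moreover have "(a - u) + (b - v) = a + b - w" by (simp add: w)
  ultimately have "a + b - w \<in> C" by (simp only:)
  then show "w \<in> ?L" using ab(1,3) by blast
qed

lemma order_cone_extension:
  fixes S :: "(int \<times> (int ^ 'k::finite)) set"
  assumes "\<And>u v. u \<in> S \<Longrightarrow> v \<in> S \<Longrightarrow> u + v \<in> S" "0 \<notin> S" "(1, 0) \<in> S"
  obtains C where "order_cone C" "S \<subseteq> C"
proof -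
  obtain T where T: "S \<subseteq> T" "\<And>u v. u \<in> T \<Longrightarrow> v \<in> T \<Longrightarrow> u + v \<in> T" "0 \<notin> T"
    "\<And>v. v \<noteq> 0 \<Longrightarrow> v \<in> T \<or> - v \<in> T"
  proof (rule total_semigroup_extension[of S], goal_cases)
    case (1 n v)
    show ?case using exponent_torsion_free[OF 1(2,3)] .
  next
    case (2 u v)
    show ?case using assms(1)[OF 2(2,3)] .
  next
    case 3
    show ?case by (rule assms(2))
  next
    case (4 T)
    show ?case using 4(2-5) by (rule 4(1))
  qed
  have antisym: "v = 0" if "v \<in> insert 0 T" "- v \<in> insert 0 T" for v
  proof (rule ccontr)
    assume "v \<noteq> 0"
    then have "v + - v \<in> T" using that by (intro T(2)) auto
    then show False using T(3) by simp
  qed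
  have total: "total_cone (insert 0 T)"
    unfolding total_cone_def
  proof (intro conjI ballI allI)
    show "u + v \<in> insert 0 T" if "u \<in> insert 0 T" "v \<in> insert 0 T" for u v
      using that T(2) by (cases "u = 0"; cases "v = 0") (simp_all del: split_paired_All)
    show "v \<in> insert 0 T \<or> - v \<in> insert 0 T" for v using T(4)[of v] by auto
    show "(1, 0) \<in> insert 0 T" using T(1) assms(3) by auto
  qed
  have "order_cone (insert 0 T)"
    unfolding order_cone_def using antisym total by blast
  then show ?thesis by (rule that) (use T(1) in blast)
qed

text \<open>A new element \<open>v\<close> of \<open>C'\<close> would have \<open>- v\<close> in
  \<open>C\<close> by totality, hence both signs in \<open>C'\<close>.\<close>

lemma order_cone_minimal:
  assumes "order_cone C" "order_cone C'" "C \<subseteq> C'"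
  shows "C = C'"
proof
  show "C' \<subseteq> C"
  proof
    fix v assume "v \<in> C'"
    show "v \<in> C"
    proof (rule ccontr)
      assume "v \<notin> C"
      then have "- v \<in> C" using total_cone_total order_imp_total_cone assms(1) by blast
      then have "v = 0" using assms \<open>v \<in> C'\<close> order_cone_antisym by blast
      then show False using \<open>v \<notin> C\<close> total_cone_zero order_imp_total_cone assms(1) by blast
    qed
  qed
qed fact

section \<open>Terms of tropical polynomials\<close>

lemma zmax_idem: "a + a = (a :: zmax)"
  by (cases a) simp_all

lemma zmax_poly_idem: "f + f = (f :: 'm \<Rightarrow>\<^sub>0 zmax)"
  by (rule poly_mapping_eqI) (simp add: lookup_add zmax_idem)

definition monomial :: "int \<times> 'm \<Rightarrow> 'm \<Rightarrow>\<^sub>0 zmax" where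
  "monomial a = Poly_Mapping.single (snd a) (TPow (fst a))"

definition terms :: "('m \<Rightarrow>\<^sub>0 zmax) \<Rightarrow> (int \<times> 'm) set" where
  "terms f = {a. Poly_Mapping.lookup f (snd a) = TPow (fst a)}"

lemma monomial_mult: "monomial a * monomial b = monomial (a + b)"
  by (simp add: monomial_def mult_single)

lemma monomial_zero: "monomial 0 = 1"
  by (simp add: monomial_def one_zmax_def[symmetric])

lemma terms_zero [simp]: "terms 0 = {}"
  by (simp add: terms_def zero_zmax_def)

lemma terms_monomial [simp]: "terms (monomial a) = {a}"
  by (auto simp: terms_def monomial_def lookup_single when_def zero_zmax_def prod_eq_iff
      split: if_splits)

lemma finite_terms [simp]: "finite (terms f)"
proof (rule finite_subset)
  show "terms f \<subseteq> (\<lambda>n. (case Poly_Mapping.lookup f n of TPow c \<Rightarrow> c | MinusInf \<Rightarrow> 0, n)) ` Poly_Mapping.keys f"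
    by (force simp: terms_def in_keys_iff zero_zmax_def)
qed simp

lemma sum_terms: "(\<Sum>a\<in>terms f. monomial a) = f"
proof (rule poly_mapping_eqI)
  fix n
  have lk: "Poly_Mapping.lookup (monomial a) n = (if a = (fst a, n) then TPow (fst a) else 0)" for a :: "int \<times> 'a"
    by (cases a) (simp add: monomial_def lookup_single when_def)
  have "Poly_Mapping.lookup (\<Sum>a\<in>terms f. monomial a) n
      = (\<Sum>a\<in>terms f. if a = (fst a, n) then TPow (fst a) else 0)"
    by (simp add: lookup_sum lk)
  also have "\<dots> = Poly_Mapping.lookup f n"
  proof (cases "Poly_Mapping.lookup f n")
    case MinusInf
    then have "(\<Sum>a\<in>terms f. if a = (fst a, n) then TPow (fst a) else 0) = 0"
      by (intro sum.neutral) (auto simp: terms_def)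
    then show ?thesis using MinusInf by (simp add: zero_zmax_def)
  next
    case (TPow c)
    then have "(\<Sum>a\<in>terms f. if a = (fst a, n) then TPow (fst a) else 0)
        = (\<Sum>a\<in>terms f. if a = (c, n) then TPow c else 0)"
      by (intro sum.cong refl) (auto simp: terms_def)
    moreover have "(c, n) \<in> terms f" using TPow by (simp add: terms_def)
    ultimately show ?thesis using TPow by simp
  qed
  finally show "Poly_Mapping.lookup (\<Sum>a\<in>terms f. monomial a) n = Poly_Mapping.lookup f n" .
qed

lemma terms_empty_iff: "terms f = {} \<longleftrightarrow> f = 0"
  using sum_terms[of f] by auto

lemma terms_add_subset: "terms (f + g) \<subseteq> terms f \<union> terms g"
proof
  fix a assume "a \<in> terms (f + g)"
  then show "a \<in> terms f \<union> terms g"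
    by (cases "Poly_Mapping.lookup f (snd a)"; cases "Poly_Mapping.lookup g (snd a)") (auto simp: terms_def lookup_add max_def split: if_splits)
qed

text \<open>In a sum a term can only be replaced by one with a larger power of t. As t \<ge> 1 in
  every cone considered, dominated exponents are not lost.\<close>

lemma terms_add_dominates:
  assumes "a \<in> terms f"
  shows "\<exists>n\<ge>0. (fst a + n, snd a) \<in> terms (f + g)"
proof (cases "Poly_Mapping.lookup g (snd a)")
  case MinusInf
  then show ?thesis using assms by (intro exI[of _ 0]) (auto simp: terms_def lookup_add)
next
  case (TPow c)
  then show ?thesis using assms
    by (intro exI[of _ "max (fst a) c - fst a"]) (auto simp: terms_def lookup_add)
qed

lemma monomial_add_t_power:
  fixes a :: "int \<times> 'm::comm_monoid_add"
  shows "n \<ge> 0 \<Longrightarrow> monomial a + monomial (a + (n, 0)) = monomial (a + (n, 0))"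
  by (simp add: monomial_def flip: single_add)

section \<open>The congruence of a cone\<close>

text \<open>Common frame for both semirings. Since differences of embedded exponents fill the group,
  a cone is determined by the comparisons between monomials, even if these are not
  invertible.\<close>

locale exponent_embedding =
  fixes emb :: "'m::cancel_comm_monoid_add \<Rightarrow> int ^ 'k::finite"
  assumes emb_add: "emb (m + n) = emb m + emb n"
    and inj_emb: "inj emb"
    and emb_differences: "\<exists>m n. v = emb m - emb n"
begin

definition ex :: "int \<times> 'm \<Rightarrow> int \<times> (int ^ 'k)" where
  "ex a = (fst a, emb (snd a))"

lemma ex_add: "ex (a + b) = ex a + ex b"
  by (simp add: ex_def emb_add)

lemma ex_eq_iff [simp]: "ex a = ex b \<longleftrightarrow> a = b"
  using inj_emb by (auto simp: ex_def prod_eq_iff inj_eq)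

lemma ex_t_power: "ex (n, 0) = (n, 0)"
  using emb_add[of 0 0] by (simp add: ex_def)

lemma ex_differences: "\<exists>a b. v = ex a - ex b"
proof -
  obtain m n where "snd v = emb m - emb n" using emb_differences by blast
  then have "v = ex (fst v, m) - ex (0, n)" by (simp add: ex_def prod_eq_iff)
  then show ?thesis by blast
qed

text \<open>Sets of dominated exponents replace leading terms, which a mere preorder does not
  determine uniquely. Addition becomes union and multiplication becomes the sum of sets.\<close>

definition down :: "(int \<times> (int ^ 'k)) set \<Rightarrow> ('m \<Rightarrow>\<^sub>0 zmax) \<Rightarrow> (int \<times> (int ^ 'k)) set" where
  "down C f = {v. \<exists>a\<in>terms f. ex a - v \<in> C}"

definition cone_congruence :: "(int \<times> (int ^ 'k)) set \<Rightarrow> ('m \<Rightarrow>\<^sub>0 zmax) rel" where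
  "cone_congruence C = {(f, g). down C f = down C g}"

lemma down_zero [simp]: "down C 0 = {}"
  by (simp add: down_def)

lemma down_monomial: "down C (monomial a) = {v. ex a - v \<in> C}"
  by (simp add: down_def)

context
  fixes C :: "(int \<times> (int ^ 'k)) set"
  assumes C: "total_cone C"
begin

lemma ex_in_down: "a \<in> terms f \<Longrightarrow> ex a \<in> down C f"
  using total_cone_zero[OF C] by (force simp: down_def)

lemma down_eq_empty_iff: "down C f = {} \<longleftrightarrow> f = 0"
proof
  assume "down C f = {}"
  then have "terms f = {}" using ex_in_down by blast
  then show "f = 0" by (simp add: terms_empty_iff)
qed simp

lemma down_downward: "v \<in> down C f \<Longrightarrow> v - u \<in> C \<Longrightarrow> u \<in> down C f"
proof -
  assume "v \<in> down C f" "v - u \<in> C"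
  then obtain a where "a \<in> terms f" "ex a - v \<in> C" by (auto simp: down_def)
  moreover have "ex a - u = (ex a - v) + (v - u)" by (simp add: algebra_simps)
  ultimately show ?thesis unfolding down_def using total_cone_add[OF C] \<open>v - u \<in> C\<close> by fastforce
qed

lemma down_add: "down C (f + g) = down C f \<union> down C g"
proof
  show "down C (f + g) \<subseteq> down C f \<union> down C g"
    using terms_add_subset[of f g] by (auto simp: down_def)
  have *: "down C f \<subseteq> down C (f + g)" for f g
  proof
    fix v assume "v \<in> down C f"
    then obtain a where a: "a \<in> terms f" "ex a - v \<in> C" by (auto simp: down_def)
    obtain n where n: "n \<ge> 0" "(fst a + n, snd a) \<in> terms (f + g)"
      using terms_add_dominates[OF a(1)] by blast
    have "(ex a - v) + (n, 0) \<in> C"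
      by (rule total_cone_add[OF C a(2) total_cone_t_power[OF C n(1)]])
    moreover have "(ex a - v) + (n, 0) = ex (fst a + n, snd a) - v"
      by (simp add: ex_def prod_eq_iff)
    ultimately have "ex (fst a + n, snd a) - v \<in> C" by (simp only:)
    then show "v \<in> down C (f + g)" using n(2) by (auto simp: down_def)
  qed
  show "down C f \<union> down C g \<subseteq> down C (f + g)"
    using *[of f g] *[of g f] by (simp add: add.commute)
qed

lemma down_sum: "finite A \<Longrightarrow> down C (sum h A) = (\<Union>i\<in>A. down C (h i))"
  by (induction A rule: finite_induct) (simp_all add: down_add)

lemma down_mult: "down C (f * g) = {u + v | u v. u \<in> down C f \<and> v \<in> down C g}"
proof -
  have "f * g = (\<Sum>a\<in>terms f. \<Sum>b\<in>terms g. monomial (a + b))"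
    by (subst (1 2) sum_terms[symmetric]) (simp add: sum_product monomial_mult)
  then have "down C (f * g) = {w. \<exists>a\<in>ex ` terms f. \<exists>b\<in>ex ` terms g. a + b - w \<in> C}"
    by (auto simp: down_sum down_monomial ex_add)
  then show ?thesis
    unfolding total_cone_lower_sum[OF C] by (simp add: down_def)
qed

lemma down_linear: "down C f \<subseteq> down C g \<or> down C g \<subseteq> down C f"
proof (rule ccontr)
  assume "\<not> ?thesis"
  then obtain u v where u: "u \<in> down C f" "u \<notin> down C g" and v: "v \<in> down C g" "v \<notin> down C f"
    by blast
  have "u - v \<in> C \<or> v - u \<in> C" using total_cone_total[OF C, of "u - v"] by auto
  then show False using u v down_downward by blast
qed

lemma down_top:
  assumes "f \<noteq> 0"
  shows "\<exists>a\<in>terms f. down C f = down C (monomial a)"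
proof -
  have fin: "\<exists>a\<in>A. down C (sum monomial A) = down C (monomial a)" if "finite A" "A \<noteq> {}" for A
    using that
  proof (induction A rule: finite_ne_induct)
    case (insert x A)
    then obtain a where "a \<in> A" "down C (sum monomial A) = down C (monomial a)" by blast
    then show ?case using insert down_linear[of "monomial x" "monomial a"]
      by (auto simp: down_add)
  qed simp
  show ?thesis
    using fin[of "terms f"] assms by (simp add: sum_terms terms_empty_iff)
qed

lemma cone_congruence_congruence: "semiring_congruence (cone_congruence C)"
  unfolding semiring_congruence_def
  by (auto simp: cone_congruence_def down_add down_mult intro!: equivI refl_onI symI transI)

text \<open>The leading term of \<open>f2\<close> lies strictly above all of \<open>f1\<close>, and
  that of \<open>g2\<close> strictly above all of \<open>g1\<close>. Their product is therefore
  strictly above both mixed products.\<close>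

lemma down_mult_not_subset:
  assumes "\<not> down C f2 \<subseteq> down C f1" "\<not> down C g2 \<subseteq> down C g1"
  shows "\<not> down C (f2 * g2) \<subseteq> down C (f1 * g2 + f2 * g1)"
proof
  assume sub: "down C (f2 * g2) \<subseteq> down C (f1 * g2 + f2 * g1)"
  have "f2 \<noteq> 0" "g2 \<noteq> 0" using assms by auto
  then obtain a b where a: "a \<in> terms f2" "down C f2 = down C (monomial a)"
    and b: "b \<in> terms g2" "down C g2 = down C (monomial b)" using down_top by metis
  have aC: "ex a - u \<in> C" if "u \<in> down C f2" for u using that a(2) by (simp add: down_monomial)
  have bC: "ex b - v \<in> C" if "v \<in> down C g2" for v using that b(2) by (simp add: down_monomial)
  have a': "ex a \<notin> down C f1" using down_downward aC assms(1) by blast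
  have b': "ex b \<notin> down C g1" using down_downward bC assms(2) by blast
  have "ex a + ex b \<in> down C (f2 * g2)"
    using ex_in_down[OF a(1)] ex_in_down[OF b(1)] unfolding down_mult by blast
  then consider u v where "ex a + ex b = u + v" "u \<in> down C f1" "v \<in> down C g2"
    | u v where "ex a + ex b = u + v" "u \<in> down C f2" "v \<in> down C g1"
    using sub unfolding down_add down_mult by blast
  then show False
  proof cases
    case (1 u v)
    then have "u - ex a = ex b - v" by (simp add: algebra_simps)
    then show ?thesis using 1 a' bC[of v] down_downward[of u f1 "ex a"] by simp
  next
    case (2 u v)
    then have "v - ex b = ex a - u" by (simp add: algebra_simps)
    then show ?thesis using 2 b' aC[of u] down_downward[of v g1 "ex b"] by simp
  qed
qed

lemma cone_congruence_zero: "(f, 0) \<in> cone_congruence C \<longleftrightarrow> f = 0"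
  using down_eq_empty_iff[of f] by (auto simp: cone_congruence_def)

theorem prime_cone_congruence: "prime_congruence (cone_congruence C)"
  unfolding prime_congruence_def proper_congruence_def
proof (intro conjI allI impI)
  show "semiring_congruence (cone_congruence C)" by (rule cone_congruence_congruence)
  show "cone_congruence C \<noteq> UNIV \<times> UNIV"
    using cone_congruence_zero[of 1] by auto
  fix \<alpha> \<beta> :: "('m \<Rightarrow>\<^sub>0 zmax) \<times> ('m \<Rightarrow>\<^sub>0 zmax)"
  obtain f1 f2 g1 g2 where ab: "\<alpha> = (f1, f2)" "\<beta> = (g1, g2)" by (cases \<alpha>; cases \<beta>)
  assume "twisted_product \<alpha> \<beta> \<in> cone_congruence C"
  then have "down C (f1 * g1) \<union> down C (f2 * g2) = down C (f1 * g2) \<union> down C (f2 * g1)"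
    by (simp add: twisted_product_def cone_congruence_def ab down_add)
  then have "down C (f1 * g1) \<subseteq> down C (f2 * g1 + f1 * g2)" "down C (f2 * g2) \<subseteq> down C (f1 * g2 + f2 * g1)"
    "down C (f1 * g2) \<subseteq> down C (f2 * g2 + f1 * g1)" "down C (f2 * g1) \<subseteq> down C (f1 * g1 + f2 * g2)"
    by (auto simp: down_add)
  \<comment> \<open>One disjunction for each way in which the two pairs could be strictly ordered;
    together they give both inclusions for the same pair.\<close>
  then have "down C f1 \<subseteq> down C f2 \<or> down C g1 \<subseteq> down C g2"
    "down C f2 \<subseteq> down C f1 \<or> down C g2 \<subseteq> down C g1"
    "down C f1 \<subseteq> down C f2 \<or> down C g2 \<subseteq> down C g1"
    "down C f2 \<subseteq> down C f1 \<or> down C g1 \<subseteq> down C g2"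
    using down_mult_not_subset[of f1 f2 g1 g2] down_mult_not_subset[of f2 f1 g2 g1]
      down_mult_not_subset[of f1 f2 g2 g1] down_mult_not_subset[of f2 f1 g1 g2] by argo+
  then have "down C f1 = down C f2 \<or> down C g1 = down C g2" by blast
  then show "\<alpha> \<in> cone_congruence C \<or> \<beta> \<in> cone_congruence C"
    by (simp add: ab cone_congruence_def)
qed

end

text \<open>The set dominated with respect to \<open>C'\<close> is obtained from the one for
  \<open>C\<close> by closing downward under \<open>C'\<close>, so equality of the latter is
  inherited.\<close>

lemma cone_congruence_mono:
  assumes "total_cone C" "total_cone C'" "C \<subseteq> C'"
  shows "cone_congruence C \<subseteq> cone_congruence C'"
proof -
  have "down C' f = {v. \<exists>u\<in>down C f. u - v \<in> C'}" for f
  proof (intro equalityI subsetI CollectI)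
    fix v assume "v \<in> down C' f"
    then obtain a where "a \<in> terms f" "ex a - v \<in> C'" unfolding down_def by blast
    then show "\<exists>u\<in>down C f. u - v \<in> C'"
      using ex_in_down[OF assms(1)] by blast
  next
    fix v assume "v \<in> {v. \<exists>u\<in>down C f. u - v \<in> C'}"
    then obtain u where "u \<in> down C f" "u - v \<in> C'" by blast
    then show "v \<in> down C' f"
      using down_downward[OF assms(2), of u f v] assms(3) unfolding down_def by blast
  qed
  then show ?thesis by (auto simp: cone_congruence_def)
qed

text \<open>The cone can be read off its congruence: \<open>ex a - ex b\<close> belongs to it
  exactly if \<open>monomial b\<close> is absorbed by \<open>monomial a\<close>.\<close>

lemma cone_congruence_mono_iff:
  assumes C: "total_cone C" and C': "total_cone C'"
  shows "cone_congruence C \<subseteq> cone_congruence C' \<longleftrightarrow> C \<subseteq> C'"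
proof
  assume sub: "cone_congruence C \<subseteq> cone_congruence C'"
  show "C \<subseteq> C'"
  proof
    fix v assume v: "v \<in> C"
    obtain a b where ab: "v = ex a - ex b" using ex_differences by blast
    then have "ex b \<in> down C (monomial a)" using v by (simp add: down_monomial)
    then have "down C (monomial b) \<subseteq> down C (monomial a)"
      using down_downward[OF C] unfolding down_monomial[of C b] by blast
    then have "(monomial a + monomial b, monomial a) \<in> cone_congruence C"
      by (auto simp: cone_congruence_def down_add[OF C])
    then have "down C' (monomial a + monomial b) = down C' (monomial a)"
      using sub unfolding cone_congruence_def by blast
    then have "down C' (monomial b) \<subseteq> down C' (monomial a)"
      by (auto simp: down_add[OF C'])
    moreover have "ex b \<in> down C' (monomial b)"
      by (rule ex_in_down[OF C']) simp
    ultimately have "ex b \<in> down C' (monomial a)" by blast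
    then show "v \<in> C'" by (simp add: ab down_monomial)
  qed
qed (rule cone_congruence_mono[OF C C'])

theorem prime_contains_cone_congruence:
  fixes P :: "('m \<Rightarrow>\<^sub>0 zmax) rel"
  assumes "prime_congruence P"
  obtains C where "order_cone C" "cone_congruence C \<subseteq> P"
proof -
  interpret idempotent_prime P by unfold_locales (fact assms zmax_poly_idem)+
  define lt where "lt a b \<longleftrightarrow> \<not> le (monomial b) (monomial a)" for a b
  \<comment> \<open>A difference enters \<open>S\<close> as soon as one pair of terms representing
    it is strict; multiplying by a term that vanishes modulo \<open>P\<close> would destroy
    strictness. Positive powers of t are adjoined because \<open>P\<close> may identify t with
    1.\<close>
  define S where "S = {v. (\<exists>a b. v = ex b - ex a \<and> lt a b) \<or> (\<exists>n>0. v = (n, 0))}"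
  have S_iff: "v \<in> S \<longleftrightarrow> (\<exists>a b. v = ex b - ex a \<and> lt a b) \<or> (\<exists>n>0. v = (n, 0))" for v
    unfolding S_def by (rule mem_Collect_eq)
  have le_t: "le (monomial a) (monomial (a + (n, 0)))" if "n \<ge> 0" for a n
    unfolding le_def monomial_add_t_power[OF that] by (rule rf)
  have lt_add: "lt (a + c) (b + d)" if "lt a b" "lt c d" for a b c d
    using strict_mult that unfolding lt_def by (simp flip: monomial_mult)
  have lt_t: "lt a (b + (n, 0))" if "lt a b" "n \<ge> 0" for a b n
    using that le_t[of n b] le_trans unfolding lt_def by blast
  have ex_t: "ex (b + (n, 0)) = ex b + (n, 0)" for b n by (simp add: ex_add ex_t_power)
  have S_t: "v + (n, 0) \<in> S" if v: "v \<in> S" and n: "n > 0" for v n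
  proof -
    consider a b where "v = ex b - ex a" "lt a b" | m where "v = (m, 0)" "m > 0"
      using v unfolding S_iff by blast
    then show ?thesis
    proof cases
      case (1 a b)
      then have "v + (n, 0) = ex (b + (n, 0)) - ex a" "lt a (b + (n, 0))"
        using n lt_t by (simp_all add: ex_t)
      then show ?thesis unfolding S_iff by blast
    next
      case (2 m)
      then show ?thesis using n by (simp add: S_iff)
    qed
  qed
  have "u + v \<in> S" if u: "u \<in> S" and v: "v \<in> S" for u v
  proof -
    consider n where "v = (n, 0)" "n > 0" | n where "u = (n, 0)" "n > 0"
      | a b c d where "u = ex b - ex a" "v = ex d - ex c" "lt a b" "lt c d"
      using u v unfolding S_iff by blast
    then show ?thesis
    proof cases
      case 1
      then show ?thesis using S_t u by simp
    next
      case 2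
      then show ?thesis using S_t v by (simp add: add.commute)
    next
      case (3 a b c d)
      then have "u + v = ex (b + d) - ex (a + c)" "lt (a + c) (b + d)"
        using lt_add by (simp_all add: ex_add)
      then show ?thesis unfolding S_iff by blast
    qed
  qed
  moreover have "0 \<notin> S"
  proof
    assume "0 \<in> S"
    then obtain a b where "0 = ex b - ex a" "lt a b" unfolding S_iff by (auto simp: zero_prod_def)
    then show False using le_refl by (simp add: lt_def)
  qed
  moreover have "(1, 0) \<in> S" by (simp add: S_iff)
  ultimately obtain C where C: "order_cone C" "S \<subseteq> C" using order_cone_extension by blast
  \<comment> \<open>A failure would be a strict inequality in the opposite direction, whose
    difference lies in \<open>S\<close> and hence in \<open>C\<close>; antisymmetry then forces
    equal exponents.\<close>
  have mono: "le (monomial a) (monomial b)" if "ex b - ex a \<in> C" for a b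
  proof (rule ccontr)
    assume n: "\<not> ?thesis"
    then have "ex a - ex b \<in> C" using C(2) unfolding subset_iff S_iff lt_def by blast
    then have "ex b - ex a = 0" using order_cone_antisym[OF C(1) that] by simp
    then show False using n le_refl by simp
  qed
  have le_down: "le f g" if "down C f \<subseteq> down C g" for f g
  proof -
    have "le (monomial a) g" if a: "a \<in> terms f" for a
    proof -
      have "ex a \<in> down C g"
        using ex_in_down[OF order_imp_total_cone[OF C(1)] a] \<open>down C f \<subseteq> down C g\<close> by blast
      then obtain b where "b \<in> terms g" "ex b - ex a \<in> C" by (auto simp: down_def)
      then show ?thesis
        using mono le_trans le_sum_member[of "terms g" b monomial] by (simp add: sum_terms) blast
    qed
    then show ?thesis using le_sum[of "terms f" monomial g] by (simp add: sum_terms)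
  qed
  have "cone_congruence C \<subseteq> P"
    using le_down le_antisym by (auto simp: cone_congruence_def)
  then show ?thesis using that C(1) by blast
qed

section \<open>Minimal primes and the radical of the trivial congruence\<close>

theorem minimal_prime_congruences:
  "{P. minimal_prime_congruence P} = {cone_congruence C | C. order_cone C}"
proof (intro equalityI subsetI)
  fix P :: "('m \<Rightarrow>\<^sub>0 zmax) rel" assume "P \<in> {P. minimal_prime_congruence P}"
  then have P: "prime_congruence P" and min: "\<And>Q. prime_congruence Q \<Longrightarrow> Q \<subseteq> P \<Longrightarrow> Q = P"
    by (auto simp: minimal_prime_congruence_def)
  obtain C where "order_cone C" "cone_congruence C \<subseteq> P"
    by (rule prime_contains_cone_congruence[OF P])
  then show "P \<in> {cone_congruence C | C. order_cone C}"
    using min[OF prime_cone_congruence[OF order_imp_total_cone]] by blast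
next
  fix P :: "('m \<Rightarrow>\<^sub>0 zmax) rel" assume "P \<in> {cone_congruence C | C. order_cone C}"
  then obtain C where C: "order_cone C" and P: "P = cone_congruence C" by blast
  have "Q = P" if Q: "prime_congruence Q" "Q \<subseteq> P" for Q
  proof -
    obtain C' where C': "order_cone C'" "cone_congruence C' \<subseteq> Q"
      by (rule prime_contains_cone_congruence[OF Q(1)])
    then have "C' \<subseteq> C"
      using Q(2) C P cone_congruence_mono_iff order_imp_total_cone by blast
    then have "C' = C" using order_cone_minimal C C'(1) by blast
    then show ?thesis using C'(2) Q(2) P by blast
  qed
  then show "P \<in> {P. minimal_prime_congruence P}"
    using prime_cone_congruence[OF order_imp_total_cone[OF C]] P
    by (simp add: minimal_prime_congruence_def)
qed

text \<open>Every prime lies above the congruence of an order cone, so the remaining primes do not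
  shrink the intersection.\<close>

lemma Rad_trivial: "congruence_Rad Id = (\<Inter>C\<in>Collect order_cone. cone_congruence C)"
proof
  show "congruence_Rad Id \<subseteq> (\<Inter>C\<in>Collect order_cone. cone_congruence C)"
    using prime_cone_congruence[OF order_imp_total_cone]
    by (auto simp: congruence_Rad_def cone_congruence_def)
  have "(\<Inter>C\<in>Collect order_cone. cone_congruence C) \<subseteq> P" if P: "prime_congruence P" for P
  proof -
    obtain C where "order_cone C" "cone_congruence C \<subseteq> P"
      by (rule prime_contains_cone_congruence[OF P])
    then show ?thesis by blast
  qed
  then show "(\<Inter>C\<in>Collect order_cone. cone_congruence C) \<subseteq> congruence_Rad Id"
    unfolding congruence_Rad_def by blast
qed

lemma order_cone_exists: "\<exists>C :: (int \<times> (int ^ 'k)) set. order_cone C"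
proof -
  obtain C :: "(int \<times> (int ^ 'k)) set" where "order_cone C"
    by (rule order_cone_extension[of "{(n, 0) | n. n > 0}"]) (auto simp: zero_prod_def)
  then show ?thesis by blast
qed

end

interpretation laurent: exponent_embedding "\<lambda>n :: int ^ 'k::finite. n"
  by unfold_locales (auto intro: diff_0_right[symmetric])

lemma laurent_ex [simp]: "laurent.ex a = a"
  by (simp add: laurent.ex_def)

section \<open>Boolean Laurent polynomials\<close>

lemma boolean_add_eq_0_iff: "x + y = 0 \<longleftrightarrow> x = 0 \<and> y = (0 :: boolean_semifield)"
  by (cases x) (simp_all add: zero_boolean_semifield_def)

lemma boolean_cases: "x = 0 \<or> x = (1 :: boolean_semifield)"
  by (cases x) (simp_all add: zero_boolean_semifield_def one_boolean_semifield_def)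

lemma boolean_idem: "x + x = (x :: boolean_semifield)"
  by (cases x) simp_all

lemma keys_boolean_add:
  "Poly_Mapping.keys (f + g) = Poly_Mapping.keys f \<union> Poly_Mapping.keys (g :: 'm \<Rightarrow>\<^sub>0 boolean_semifield)"
  by (auto simp: in_keys_iff lookup_add boolean_add_eq_0_iff)

lemma keys_boolean_sum:
  "finite A \<Longrightarrow> Poly_Mapping.keys (\<Sum>a\<in>A. h a :: 'm \<Rightarrow>\<^sub>0 boolean_semifield) = (\<Union>a\<in>A. Poly_Mapping.keys (h a))"
  by (induction A rule: finite_induct) (simp_all add: keys_boolean_add)

lemma sum_boolean_keys:
  "(\<Sum>a\<in>Poly_Mapping.keys f. Poly_Mapping.single a 1) = (f :: 'm \<Rightarrow>\<^sub>0 boolean_semifield)"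
proof (rule poly_mapping_eqI)
  fix n
  have "Poly_Mapping.lookup (\<Sum>a\<in>Poly_Mapping.keys f. Poly_Mapping.single a 1) n
      = (\<Sum>a\<in>Poly_Mapping.keys f. if a = n then 1 else 0)"
    by (simp add: lookup_sum lookup_single when_def)
  also have "\<dots> = Poly_Mapping.lookup f n"
    using boolean_cases[of "Poly_Mapping.lookup f n"] by (auto simp: in_keys_iff)
  finally show "Poly_Mapping.lookup (\<Sum>a\<in>Poly_Mapping.keys f. Poly_Mapping.single a 1) n
    = Poly_Mapping.lookup f n" .
qed

lemma keys_boolean_mult:
  fixes f g :: "'m::comm_monoid_add \<Rightarrow>\<^sub>0 boolean_semifield"
  shows "Poly_Mapping.keys (f * g) = (\<Union>a\<in>Poly_Mapping.keys f. \<Union>b\<in>Poly_Mapping.keys g. {a + b})"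
proof -
  have "f * g = (\<Sum>a\<in>Poly_Mapping.keys f. \<Sum>b\<in>Poly_Mapping.keys g. Poly_Mapping.single (a + b) 1)"
    by (subst (1 2) sum_boolean_keys[symmetric]) (simp add: sum_product mult_single)
  then show ?thesis by (simp add: keys_boolean_sum)
qed

lemma zmax_of_bool_laurent_sum:
  "zmax_of_bool_laurent f = (\<Sum>a\<in>Poly_Mapping.keys f. monomial a)"
  by (simp add: zmax_of_bool_laurent_def monomial_def case_prod_beta)

lemma down_zmax_of_bool_laurent:
  assumes "total_cone C"
  shows "laurent.down C (zmax_of_bool_laurent f) = {v. \<exists>a\<in>Poly_Mapping.keys f. a - v \<in> C}"
  by (auto simp: zmax_of_bool_laurent_sum laurent.down_sum[OF assms] laurent.down_monomial)

section \<open>Matrices and cones\<close>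

definition matrix_cone :: "('k::finite) real_matrix \<Rightarrow> (int \<times> (int ^ 'k)) set" where
  "matrix_cone U = {v. zero_or_first_pos (mat_apply U (real_exponent v))}"

section \<open>The lexicographic sign of a vector\<close>

lemma first_nonzero_at_Cons_0: "first_nonzero_at (x # xs) 0 \<longleftrightarrow> x \<noteq> 0"
  by (simp add: first_nonzero_at_def)

lemma first_nonzero_at_Cons_Suc:
  "first_nonzero_at (x # xs) (Suc i) \<longleftrightarrow> x = 0 \<and> first_nonzero_at xs i"
  by (auto simp: first_nonzero_at_def less_Suc_eq_0_disj)

lemma zero_or_first_pos_Nil [simp]: "zero_or_first_pos []"
  by (simp add: zero_or_first_pos_def)

lemma zero_or_first_pos_Cons:
  "zero_or_first_pos (x # xs) \<longleftrightarrow> x > 0 \<or> x = 0 \<and> zero_or_first_pos xs"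
proof -
  have "(\<exists>i. Q i) \<longleftrightarrow> Q 0 \<or> (\<exists>i. Q (Suc i))" for Q :: "nat \<Rightarrow> bool"
    by (metis not0_implies_Suc)
  from this[of "\<lambda>i. first_nonzero_at (x # xs) i \<and> (x # xs) ! i > 0"] show ?thesis
    by (auto simp: zero_or_first_pos_def first_nonzero_at_Cons_0 first_nonzero_at_Cons_Suc)
qed

lemma mat_apply_Nil [simp]: "mat_apply [] v = []"
  and mat_apply_Cons [simp]: "mat_apply (r # U) v = r \<bullet> v # mat_apply U v"
  by (simp_all add: mat_apply_def)

lemma zero_or_first_pos_mat_add:
  "zero_or_first_pos (mat_apply U v) \<Longrightarrow> zero_or_first_pos (mat_apply U w) \<Longrightarrow>
    zero_or_first_pos (mat_apply U (v + w))"
  by (induction U) (auto simp: zero_or_first_pos_Cons inner_add_right)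

lemma zero_or_first_pos_mat_total:
  "zero_or_first_pos (mat_apply U v) \<or> zero_or_first_pos (mat_apply U (- v))"
  by (induction U) (auto simp: zero_or_first_pos_Cons inner_minus_right)

lemma zero_or_first_pos_mat_antisym:
  "zero_or_first_pos (mat_apply U v) \<Longrightarrow> zero_or_first_pos (mat_apply U (- v)) \<Longrightarrow> v \<in> mat_Ker U"
  by (induction U) (auto simp: zero_or_first_pos_Cons inner_minus_right mat_Ker_def)

lemma mat_apply_t: "mat_apply U (real_exponent (1, 0)) = map fst U"
  by (simp add: mat_apply_def real_exponent_def inner_prod_def zero_vec_def[symmetric])

lemma total_cone_matrix_cone:
  assumes "zero_or_first_pos (map fst U)"
  shows "total_cone (matrix_cone U)"
  unfolding total_cone_def matrix_cone_def
proof (intro conjI ballI allI)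
  show "(1, 0) \<in> {v. zero_or_first_pos (mat_apply U (real_exponent v))}"
    using assms by (simp add: mat_apply_t)
qed (use zero_or_first_pos_mat_total zero_or_first_pos_mat_add
    in \<open>simp_all add: real_exponent_add real_exponent_uminus\<close>)

lemma order_cone_matrix_cone:
  assumes "z_admissible U" "mat_Ker U \<inter> range real_exponent = {0}"
  shows "order_cone (matrix_cone U)"
proof -
  have antisym: "v = 0" if "v \<in> matrix_cone U" "- v \<in> matrix_cone U" for v
  proof -
    have "real_exponent v \<in> mat_Ker U"
      using that zero_or_first_pos_mat_antisym by (simp add: matrix_cone_def real_exponent_uminus)
    then have "real_exponent v = 0" using assms(2) by blast
    then show ?thesis by simp
  qed
  have "total_cone (matrix_cone U)"
    using assms(1) by (intro total_cone_matrix_cone) (simp add: z_admissible_def)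
  then show ?thesis
    unfolding order_cone_def using antisym by blast
qed

text \<open>The rows are found one at a time: the exponents \<open>v > 0\<close> of the current subgroup \<open>H\<close> do not
  have \<open>0\<close> in their convex hull, and the normal vector of a separating hyperplane is the next row.\<close>

lemma matrix_of_order_cone_on:
  fixes H :: "(int \<times> (int ^ 'k::finite)) set"
  assumes C: "order_cone C" and add: "\<And>u v. u \<in> H \<Longrightarrow> v \<in> H \<Longrightarrow> u + v \<in> H"
    and uminus: "\<And>v. v \<in> H \<Longrightarrow> - v \<in> H"
  shows "\<exists>U. (\<forall>i<length U. \<exists>v\<in>H. first_nonzero_at (mat_apply U (real_exponent v)) i) \<and>
    (\<forall>v\<in>H. v \<in> C \<longleftrightarrow> v \<in> matrix_cone U)"
  using add uminus
proof (induction "dim (real_exponent ` H)" arbitrary: H rule: less_induct)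
  case less
  note Hadd = less.prems(1) and Hminus = less.prems(2)
  note tot = order_imp_total_cone[OF C]
  define S where "S = H \<inter> C - {0}"
  show ?case
  proof (cases "S = {}")
    case True
    \<comment> \<open>Without positive exponents \<open>H\<close> contains at most 0, and the matrix
      with no rows suffices.\<close>
    have "v \<in> C" if "v \<in> H" for v
    proof (cases "v \<in> C")
      case False
      then have "- v \<in> C" "- v \<noteq> 0" using total_cone_total[OF tot] total_cone_zero[OF tot] by auto
      then show ?thesis using True Hminus[OF that] unfolding S_def by blast
    qed
    then show ?thesis by (intro exI[of _ "[]"]) (simp add: matrix_cone_def)
  next
    case False
    have "u + v \<in> S" if "u \<in> S" "v \<in> S" for u v
      using that Hadd order_cone_positive_add[OF C, of u v] by (simp add: S_def)
    then have "0 \<notin> convex hull (real_exponent ` S)"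
      by (rule zero_notin_convex_hull_semigroup) (simp_all add: S_def)
    \<comment> \<open>A nonzero \<open>r\<close> in the span of \<open>H\<close> cannot be
      orthogonal to \<open>H\<close>. Hence the new row is nonzero on \<open>H\<close>, as
      admissibility demands, and the exponents that it leaves undecided span a smaller
      space.\<close>
    then obtain r where r: "r \<in> span (convex hull (real_exponent ` S))" "r \<noteq> 0"
      "\<And>x. x \<in> convex hull (real_exponent ` S) \<Longrightarrow> 0 \<le> r \<bullet> x"
      using separating_hyperplane_set_0_inspan[OF convex_convex_hull] False
      by (metis convex_hull_eq_empty image_is_empty)
    have rS: "0 \<le> r \<bullet> real_exponent v" if "v \<in> S" for v
      using r(3) that by (meson hull_subset image_eqI subset_iff)
    have "span (convex hull (real_exponent ` S)) \<subseteq> span (real_exponent ` S)"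
      by (simp add: convex_hull_subset_span span_minimal)
    then have rspan: "r \<in> span (real_exponent ` H)"
      using r(1) span_mono[of "real_exponent ` S" "real_exponent ` H"] unfolding S_def by blast
    define H' where "H' = {v \<in> H. r \<bullet> real_exponent v = 0}"
    have orth: "r \<bullet> x = 0" if "x \<in> span (real_exponent ` H')" for x
      using that by (induction rule: span_induct_alt) (auto simp: H'_def inner_add_right inner_scaleR_right)
    have "span (real_exponent ` H') \<subset> span (real_exponent ` H)"
    proof
      show "span (real_exponent ` H') \<subseteq> span (real_exponent ` H)"
        by (intro span_mono image_mono) (auto simp: H'_def)
      show "span (real_exponent ` H') \<noteq> span (real_exponent ` H)"
        using rspan orth[of r] r(2) by auto
    qed
    then have "dim (real_exponent ` H') < dim (real_exponent ` H)" by (rule dim_psubset)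
    moreover have "u + v \<in> H'" if "u \<in> H'" "v \<in> H'" for u v
      using that Hadd unfolding H'_def by (simp add: real_exponent_add inner_add_right)
    moreover have "- v \<in> H'" if "v \<in> H'" for v
      using that Hminus unfolding H'_def by (simp add: real_exponent_uminus)
    ultimately obtain U where U: "\<And>i. i < length U \<Longrightarrow> \<exists>v\<in>H'. first_nonzero_at (mat_apply U (real_exponent v)) i"
      "\<And>v. v \<in> H' \<Longrightarrow> v \<in> C \<longleftrightarrow> v \<in> matrix_cone U"
      using less.hyps[of H'] by blast
    have adm: "\<exists>v\<in>H. first_nonzero_at (mat_apply (r # U) (real_exponent v)) i"
      if i: "i < length (r # U)" for i
    proof (cases i)
      case 0
      have "\<exists>v\<in>H. r \<bullet> real_exponent v \<noteq> 0"
      proof (rule ccontr)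
        assume "\<not> ?thesis"
        then have "H' = H" by (auto simp: H'_def)
        then show False using orth[of r] rspan r(2) by simp
      qed
      then show ?thesis using 0 by (simp add: first_nonzero_at_Cons_0)
    next
      case (Suc j)
      then obtain v where "v \<in> H'" "first_nonzero_at (mat_apply U (real_exponent v)) j"
        using i U(1)[of j] by (metis Suc_less_eq length_Cons)
      then show ?thesis using Suc by (auto simp: H'_def first_nonzero_at_Cons_Suc)
    qed
    have cone: "v \<in> C \<longleftrightarrow> v \<in> matrix_cone (r # U)" if v: "v \<in> H" for v
    proof -
      have H_C: "0 \<le> r \<bullet> real_exponent u" if "u \<in> H" "u \<in> C" for u
        using rS[of u] that by (cases "u = 0") (auto simp: S_def)
      consider "r \<bullet> real_exponent v > 0" | "r \<bullet> real_exponent v < 0" | "v \<in> H'"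
        using v by (force simp: H'_def)
      then show ?thesis
      proof cases
        case 1
        then have "- v \<notin> C" using H_C[OF Hminus[OF v]] by (auto simp: real_exponent_uminus)
        then have "v \<in> C" using total_cone_total[OF tot, of "- v"] by auto
        then show ?thesis using 1 by (simp add: matrix_cone_def zero_or_first_pos_Cons)
      next
        case 2
        then show ?thesis using H_C[OF v] by (auto simp: matrix_cone_def zero_or_first_pos_Cons)
      next
        case 3
        then show ?thesis using U(2) by (simp add: matrix_cone_def zero_or_first_pos_Cons H'_def)
      qed
    qed
    show ?thesis using adm cone by blast
  qed
qed

theorem matrix_of_order_cone:
  fixes C :: "(int \<times> (int ^ 'k::finite)) set"
  assumes C: "order_cone C"
  obtains U where "z_admissible U" "mat_Ker U \<inter> range real_exponent = {0}" "matrix_cone U = C"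
proof -
  obtain U where U: "\<forall>i<length U. \<exists>v\<in>UNIV. first_nonzero_at (mat_apply U (real_exponent v)) i"
    and "\<forall>v\<in>UNIV. v \<in> C \<longleftrightarrow> v \<in> matrix_cone U"
    using matrix_of_order_cone_on[OF C, of UNIV] by blast
  then have cone: "matrix_cone U = C" by blast
  have "(1, 0) \<in> matrix_cone U"
    using total_cone_t[OF order_imp_total_cone[OF C]] cone by simp
  then have adm: "z_admissible U"
    using U by (simp add: z_admissible_def admissible_def matrix_cone_def mat_apply_t)
  have zero: "zero_or_first_pos (mat_apply U x)" if "x \<in> mat_Ker U" for x
    using that by (simp add: zero_or_first_pos_def mat_Ker_def)
  have "v = 0" if "real_exponent v \<in> mat_Ker U" for v
  proof -
    have "- real_exponent v \<in> mat_Ker U" using that by (simp add: mat_Ker_def mat_apply_def)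
    then have "v \<in> matrix_cone U" "- v \<in> matrix_cone U"
      using that zero by (simp_all add: matrix_cone_def real_exponent_uminus)
    then show ?thesis using order_cone_antisym[OF C] cone by simp
  qed
  moreover have "0 \<in> mat_Ker U" by (simp add: mat_Ker_def mat_apply_def)
  ultimately have "mat_Ker U \<inter> range real_exponent = {0}"
    by (auto intro: range_eqI[of _ _ 0])
  then show ?thesis using that adm cone by blast
qed

lemma order_cones_eq_matrix_cones:
  "Collect order_cone
    = matrix_cone ` {U :: ('k::finite) real_matrix. z_admissible U \<and> mat_Ker U \<inter> range real_exponent = {0}}"
proof (intro equalityI subsetI)
  fix C :: "(int \<times> (int ^ 'k)) set" assume "C \<in> Collect order_cone"
  then obtain U where "z_admissible U" "mat_Ker U \<inter> range real_exponent = {0}" "matrix_cone U = C"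
    using matrix_of_order_cone by blast
  then show "C \<in> matrix_cone ` {U. z_admissible U \<and> mat_Ker U \<inter> range real_exponent = {0}}" by blast
qed (use order_cone_matrix_cone in blast)

section \<open>The congruence of a matrix as the congruence of its cone\<close>

lemma P_cong_lower:
  fixes U :: "('k::finite) real_matrix"
  assumes "\<And>a. a \<in> A \<Longrightarrow> \<exists>b\<in>Poly_Mapping.keys g. b - a \<in> matrix_cone U" "finite A"
  shows "((\<Sum>a\<in>A. Poly_Mapping.single a 1) + g, g) \<in> P_cong U"
  unfolding P_cong_def generated_congruence_def
proof (intro InterI)
  fix J :: "'k bool_laurent rel" assume "J \<in> {I. semiring_congruence I \<and>
    {(Poly_Mapping.single n1 1 + Poly_Mapping.single n2 1, Poly_Mapping.single n2 1) | n1 n2.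
      zero_or_first_pos (mat_apply U (real_exponent (n2 - n1)))} \<subseteq> I}"
  then have J: "semiring_congruence J" and gen: "\<And>a b. b - a \<in> matrix_cone U \<Longrightarrow>
      (Poly_Mapping.single a 1 + Poly_Mapping.single b 1, Poly_Mapping.single b 1) \<in> J"
    unfolding matrix_cone_def by blast+
  show "((\<Sum>a\<in>A. Poly_Mapping.single a 1) + g, g) \<in> J"
    using assms(2,1)
  proof (induction A rule: finite_induct)
    case empty
    then show ?case by (simp add: congruence_refl[OF J])
  next
    case (insert a A)
    obtain b where b: "b \<in> Poly_Mapping.keys g" "b - a \<in> matrix_cone U" using insert.prems by blast
    \<comment> \<open>\<open>b\<close> already occurs in \<open>g\<close>, so \<open>g\<close>
      absorbs it; through \<open>b\<close> it then absorbs the dominated monomial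
      \<open>a\<close>.\<close>
    have g: "Poly_Mapping.single b 1 + g = g"
    proof (rule poly_mapping_eqI)
      fix n
      show "Poly_Mapping.lookup (Poly_Mapping.single b 1 + g) n = Poly_Mapping.lookup g n"
        using b(1) boolean_cases[of "Poly_Mapping.lookup g n"]
        by (auto simp: lookup_add lookup_single when_def in_keys_iff boolean_idem)
    qed
    have "(Poly_Mapping.single a 1 + ((\<Sum>a\<in>A. Poly_Mapping.single a 1) + g), Poly_Mapping.single a 1 + g) \<in> J"
      using insert by (intro congruence_add[OF J] congruence_refl[OF J]) auto
    moreover have "((Poly_Mapping.single a 1 + Poly_Mapping.single b 1) + g, Poly_Mapping.single b 1 + g) \<in> J"
      by (intro congruence_add[OF J] congruence_refl[OF J] gen b)
    ultimately show ?case
      using insert.hyps congruence_trans[OF J] by (simp add: add.assoc g)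
  qed
qed

text \<open>The pullback \<open>K\<close> of the cone congruence is a congruence containing the
  generators, which gives one inclusion. Conversely, if two polynomials dominate the same exponents,
  their Boolean lifts absorb each other modulo \<open>P_cong U\<close>.\<close>

theorem P_cong_Z_eq:
  fixes U :: "('k::finite) real_matrix"
  assumes "zero_or_first_pos (map fst U)"
  shows "P_cong_Z U = laurent.cone_congruence (matrix_cone U)"
proof -
  let ?C = "matrix_cone U" and ?z = "zmax_of_bool_laurent :: 'k bool_laurent \<Rightarrow> 'k zmax_laurent"
  note C = total_cone_matrix_cone[OF assms]
  note dz = down_zmax_of_bool_laurent[OF C]
  define K where "K = {(f, g). laurent.down ?C (?z f) = laurent.down ?C (?z g)}"
  have z_add: "laurent.down ?C (?z (f + g)) = laurent.down ?C (?z f) \<union> laurent.down ?C (?z g)" for f g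
    unfolding dz keys_boolean_add by blast
  have z_mult: "laurent.down ?C (?z (f * g))
      = {u + v | u v. u \<in> laurent.down ?C (?z f) \<and> v \<in> laurent.down ?C (?z g)}" for f g
    unfolding dz keys_boolean_mult by (subst total_cone_lower_sum[OF C, symmetric]) blast
  have "semiring_congruence K"
    unfolding semiring_congruence_def K_def
    by (auto simp: z_add z_mult intro!: equivI refl_onI symI transI)
  moreover have "(Poly_Mapping.single a 1 + Poly_Mapping.single b 1, Poly_Mapping.single b 1) \<in> K"
    if ab: "zero_or_first_pos (mat_apply U (real_exponent (b - a)))" for a b
  proof -
    have "b - v \<in> ?C" if v: "a - v \<in> ?C" for v
    proof -
      have "(b - a) + (a - v) \<in> ?C"
        by (rule total_cone_add[OF C _ v]) (simp add: matrix_cone_def ab)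
      then show ?thesis by simp
    qed
    then show ?thesis by (simp add: K_def dz keys_boolean_add) blast
  qed
  ultimately have "P_cong U \<subseteq> K"
    unfolding P_cong_def generated_congruence_def by blast
  then have "P_cong_Z U \<subseteq> laurent.cone_congruence ?C"
    unfolding P_cong_Z_def K_def laurent.cone_congruence_def by auto
  moreover have "laurent.cone_congruence ?C \<subseteq> P_cong_Z U"
  proof (rule subrelI)
    fix f g :: "'k zmax_laurent" assume fg: "(f, g) \<in> laurent.cone_congruence ?C"
    \<comment> \<open>A section of the surjection onto the tropical semiring: the Boolean polynomial
      supported on the terms of \<open>h\<close>.\<close>
    define lift :: "'k zmax_laurent \<Rightarrow> 'k bool_laurent" where "lift h = (\<Sum>a\<in>terms h. Poly_Mapping.single a 1)" for h
    have keys: "Poly_Mapping.keys (lift h) = terms h" for h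
      by (simp add: lift_def keys_boolean_sum)
    have z: "?z (lift h) = h" for h
      by (simp add: zmax_of_bool_laurent_sum keys sum_terms)
    have le: "(lift f + lift g, lift g) \<in> P_cong U"
      if fg: "laurent.down ?C f = laurent.down ?C g" for f g
      unfolding lift_def[of f]
    proof (rule P_cong_lower)
      fix a assume "a \<in> terms f"
      then have "a \<in> laurent.down ?C g"
        using laurent.ex_in_down[OF C, of a f] fg by simp
      then show "\<exists>b\<in>Poly_Mapping.keys (lift g). b - a \<in> ?C"
        by (simp add: keys laurent.down_def)
    qed simp
    have cong: "semiring_congruence (P_cong U)"
      unfolding P_cong_def generated_congruence_def by (intro semiring_congruence_Inter) simp
    have "(lift f + lift g, lift g) \<in> P_cong U" "(lift g + lift f, lift f) \<in> P_cong U"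
      using fg le by (simp_all add: laurent.cone_congruence_def)
    then have "(lift f, lift g) \<in> P_cong U"
      using congruence_sym[OF cong] congruence_trans[OF cong] by (metis add.commute)
    then show "(f, g) \<in> P_cong_Z U"
      unfolding P_cong_Z_def using z by (metis image_eqI map_prod_simp)
  qed
  ultimately show ?thesis by blast
qed

section \<open>Newton polytopes and order cones\<close>

lemma convex_reflection:
  assumes "convex S"
  shows "convex {p :: 'a::real_vector. x - p \<in> S}"
proof (rule convexI, rule CollectI)
  fix p q and u v :: real
  assume pq: "p \<in> {p. x - p \<in> S}" "q \<in> {p. x - p \<in> S}" and uv: "0 \<le> u" "0 \<le> v" "u + v = 1"
  have "u *\<^sub>R (x - p) + v *\<^sub>R (x - q) \<in> S"
    using pq uv by (intro convexD[OF assms]) auto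
  moreover have "u *\<^sub>R (x - p) + v *\<^sub>R (x - q) = (u + v) *\<^sub>R x - (u *\<^sub>R p + v *\<^sub>R q)"
    by (simp only: scaleR_right_diff_distrib scaleR_left_distrib) simp
  ultimately show "x - (u *\<^sub>R p + v *\<^sub>R q) \<in> S" using uv(3) by simp
qed

text \<open>The vertical fibre of the polytope through \<open>a\<close> is compact, and its highest
  point lies on the hat.\<close>

lemma hat_above:
  assumes "finite A" "a \<in> A"
  obtains s where "s \<ge> 0" "real_exponent a + (s, 0) \<in> upper_hat (convex hull (real_exponent ` A))"
proof -
  let ?N = "convex hull (real_exponent ` A)"
  let ?F = "?N \<inter> {p. snd p = snd (real_exponent a)}"
  have "compact (fst ` ?F)"
  proof (intro compact_continuous_image compact_Int_closed continuous_on_fst continuous_on_id)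
    show "compact ?N" using assms(1) by (simp add: finite_imp_compact_convex_hull)
    show "closed {p. snd p = snd (real_exponent a)}"
      by (intro closed_Collect_eq continuous_on_snd continuous_on_id continuous_on_const)
  qed
  moreover have aF: "real_exponent a \<in> ?F" using assms(2) by (simp add: hull_inc)
  then have "fst ` ?F \<noteq> {}" by blast
  ultimately obtain y where y: "y \<in> fst ` ?F" "\<And>z. z \<in> fst ` ?F \<Longrightarrow> z \<le> y"
    using compact_attains_sup by metis
  have "(y, snd (real_exponent a)) \<in> ?N" using y(1) by force
  moreover have "(z, snd (real_exponent a)) \<notin> ?N" if "z > y" for z
  proof
    assume "(z, snd (real_exponent a)) \<in> ?N"
    then have "z \<in> fst ` ?F" by force
    then show False using y(2) that by fastforce
  qed
  moreover have "fst (real_exponent a) \<le> y" using y(2) aF by blast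
  moreover have "real_exponent a + (y - fst (real_exponent a), 0) = (y, snd (real_exponent a))"
    by (simp add: prod_eq_iff)
  ultimately show ?thesis
    using that[of "y - fst (real_exponent a)"] unfolding upper_hat_def by simp
qed

text \<open>If no \<open>b\<close> dominates \<open>a\<close>, all \<open>a - b\<close> are
  positive, so the hull of \<open>B\<close> lies in the reflection of the hull \<open>?K\<close> of
  the positive exponents. The hat point above \<open>a\<close> then puts \<open>(- s, 0)\<close>
  into \<open>?K\<close>. Weighted against \<open>(1, 0)\<close>, it yields 0, which
  \<open>?K\<close> does not contain.\<close>

lemma dominated_if_hat_subset:
  fixes A B :: "(int \<times> (int ^ 'k::finite)) set"
  assumes C: "order_cone C" and A: "finite A" "a \<in> A"
    and hat: "upper_hat (convex hull (real_exponent ` A)) \<subseteq> convex hull (real_exponent ` B)"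
  shows "\<exists>b\<in>B. b - a \<in> C"
proof (rule ccontr)
  assume none: "\<not> ?thesis"
  note tot = order_imp_total_cone[OF C]
  define T where "T = C - {0}"
  let ?K = "convex hull (real_exponent ` T)"
  obtain s where s: "s \<ge> 0" and "real_exponent a + (s, 0) \<in> convex hull (real_exponent ` B)"
    using hat_above[OF A] hat by blast
  moreover have "real_exponent ` B \<subseteq> {p. real_exponent a - p \<in> ?K}"
  proof
    fix p assume "p \<in> real_exponent ` B"
    then obtain b where b: "b \<in> B" "p = real_exponent b" by blast
    have "b - a \<notin> C" using none b(1) by blast
    moreover have "- (b - a) \<in> C" using total_cone_total[OF tot calculation] .
    ultimately have "a - b \<in> T" using total_cone_zero[OF tot] by (auto simp: T_def)
    then show "p \<in> {p. real_exponent a - p \<in> ?K}"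
      by (simp add: b(2) real_exponent_diff[symmetric] hull_inc)
  qed
  then have "convex hull (real_exponent ` B) \<subseteq> {p. real_exponent a - p \<in> ?K}"
    by (intro hull_minimal convex_reflection convex_convex_hull)
  ultimately have "real_exponent a - (real_exponent a + (s, 0)) \<in> ?K" by blast
  then have 1: "(- s, 0) \<in> ?K" by simp
  have "(1, 0) \<in> T" using total_cone_t[OF tot] by (simp add: T_def zero_prod_def)
  then have "real_exponent (1, 0) \<in> ?K" by (simp add: hull_inc)
  then have 2: "(1, 0) \<in> ?K" by (simp add: real_exponent_def zero_vec_def)
  have "(1 / (1 + s)) *\<^sub>R (- s, 0) + (s / (1 + s)) *\<^sub>R (1, 0) \<in> ?K"
    using s by (intro convexD[OF convex_convex_hull 1 2]) (auto simp: field_simps)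
  then have "0 \<in> ?K" by (simp add: zero_prod_def)
  moreover have "0 \<notin> ?K"
    unfolding T_def by (rule zero_notin_convex_hull_semigroup[OF order_cone_positive_add[OF C]]) simp_all
  ultimately show False by blast
qed

text \<open>If \<open>a\<close> is not below the hull of \<open>B\<close>, the integral positive
  multiples of vectors from \<open>?L\<close> to \<open>a\<close> form a semigroup without 0. With
  the positive powers of t it extends to an order in which \<open>a\<close> is at least every
  \<open>b\<close>, so a dominating \<open>b\<close> would have to equal \<open>a\<close>.\<close>

lemma hull_below_if_dominated:
  fixes A B :: "(int \<times> (int ^ 'k::finite)) set"
  assumes dom: "\<And>C a. order_cone C \<Longrightarrow> a \<in> A \<Longrightarrow> \<exists>b\<in>B. b - a \<in> C"
  shows "convex hull (real_exponent ` A) \<subseteq> {p. \<exists>s\<ge>0. p + (s, 0) \<in> convex hull (real_exponent ` B)}"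
    (is "_ \<subseteq> ?L")
proof (rule hull_minimal)
  have BL: "real_exponent ` B \<subseteq> ?L"
    by (auto intro!: exI[of _ 0] simp: hull_inc simp flip: zero_prod_def)
  show convex_L: "convex ?L"
  proof (rule convexI)
    fix p q and u v :: real
    assume pq: "p \<in> ?L" "q \<in> ?L" and uv: "0 \<le> u" "0 \<le> v" "u + v = 1"
    then obtain s r where s: "s \<ge> 0" "p + (s, 0) \<in> convex hull (real_exponent ` B)"
      and r: "r \<ge> 0" "q + (r, 0) \<in> convex hull (real_exponent ` B)" by blast
    have "u *\<^sub>R (p + (s, 0)) + v *\<^sub>R (q + (r, 0)) \<in> convex hull (real_exponent ` B)"
      by (intro convexD[OF convex_convex_hull] s r uv)
    moreover have "u *\<^sub>R (p + (s, 0)) + v *\<^sub>R (q + (r, 0)) = (u *\<^sub>R p + v *\<^sub>R q) + (u * s + v * r, 0)"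
      by (simp add: prod_eq_iff algebra_simps)
    moreover have "u * s + v * r \<ge> 0" using s r uv by simp
    ultimately show "u *\<^sub>R p + v *\<^sub>R q \<in> ?L" by auto
  qed
  show "real_exponent ` A \<subseteq> ?L"
  proof (rule image_subsetI, rule ccontr)
    fix a assume a: "a \<in> A" "real_exponent a \<notin> ?L"
    define S1 where "S1 = {v. \<exists>l>0. \<exists>p\<in>?L. real_exponent v = l *\<^sub>R (real_exponent a - p)}"
    define S where "S = S1 \<union> {(n, 0) | n. n > 0}"
    have S1_add: "u + v \<in> S1" if "u \<in> S1" "v \<in> S1" for u v
    proof -
      obtain l p m q where l: "l > 0" "p \<in> ?L" "real_exponent u = l *\<^sub>R (real_exponent a - p)"
        and m: "m > 0" "q \<in> ?L" "real_exponent v = m *\<^sub>R (real_exponent a - q)"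
        using \<open>u \<in> S1\<close> \<open>v \<in> S1\<close> unfolding S1_def by blast
      have "(l / (l + m)) *\<^sub>R p + (m / (l + m)) *\<^sub>R q \<in> ?L"
        by (rule convexD[OF convex_L l(2) m(2)]) (use l(1) m(1) in \<open>simp_all flip: add_divide_distrib\<close>)
      moreover have "real_exponent (u + v)
          = (l + m) *\<^sub>R (real_exponent a - ((l / (l + m)) *\<^sub>R p + (m / (l + m)) *\<^sub>R q))"
        using l m by (simp add: real_exponent_add scaleR_right_distrib scaleR_right_diff_distrib
            scaleR_left_distrib)
      moreover have "l + m > 0" using l(1) m(1) by simp
      ultimately show ?thesis unfolding S1_def by blast
    qed
    have S1_t: "v + (n, 0) \<in> S1" if v: "v \<in> S1" and n: "n > 0" for v n
    proof -
      obtain l p where l: "l > 0" "p \<in> ?L" "real_exponent v = l *\<^sub>R (real_exponent a - p)"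
        using v unfolding S1_def by blast
      obtain s where s: "s \<ge> 0" "p + (s, 0) \<in> convex hull (real_exponent ` B)" using l(2) by blast
      \<comment> \<open>\<open>?L\<close> is closed under lowering the first coordinate; the shift
        by \<open>n / l\<close> becomes \<open>n\<close> after scaling by \<open>l\<close>.\<close>
      have "p - (of_int n / l, 0) + (s + of_int n / l, 0) = p + (s, 0)"
        by (simp add: prod_eq_iff)
      then have "p - (of_int n / l, 0) + (s + of_int n / l, 0) \<in> convex hull (real_exponent ` B)"
        using s(2) by (simp only:)
      moreover have "s + of_int n / l \<ge> 0" using s(1) l(1) n by simp
      ultimately have "p - (of_int n / l, 0) \<in> ?L" by blast
      moreover have "real_exponent (v + (n, 0)) = l *\<^sub>R (real_exponent a - (p - (of_int n / l, 0)))"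
        using l by (simp add: real_exponent_add prod_eq_iff algebra_simps)
          (simp add: real_exponent_def vec_eq_iff)
      ultimately show ?thesis using l(1) unfolding S1_def by blast
    qed
    have "u + v \<in> S" if u: "u \<in> S" and v: "v \<in> S" for u v
    proof -
      consider "u \<in> S1" "v \<in> S1" | n where "u \<in> S1" "v = (n, 0)" "n > 0"
        | n where "v \<in> S1" "u = (n, 0)" "n > 0" | n m where "u = (n, 0)" "n > 0" "v = (m, 0)" "m > 0"
        using u v unfolding S_def by blast
      then show ?thesis
      proof cases
        case 3
        then show ?thesis using S1_t[of v n] by (simp add: S_def add.commute[of _ v])
      qed (auto simp: S_def intro: S1_add S1_t)
    qed
    moreover have "0 \<notin> S"
    proof
      assume "0 \<in> S"
      then have "0 \<in> S1" by (auto simp: S_def zero_prod_def)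
      then obtain l p where l: "l > 0" "p \<in> ?L" "real_exponent 0 = l *\<^sub>R (real_exponent a - p)"
        unfolding S1_def by blast
      have "l *\<^sub>R (real_exponent a - p) = 0" using l(3) by simp
      then have "p = real_exponent a" using l(1) by simp
      then show False using l(2) a(2) by simp
    qed
    moreover have "(1, 0) \<in> S" by (simp add: S_def)
    ultimately obtain C where C: "order_cone C" "S \<subseteq> C" using order_cone_extension by blast
    obtain b where b: "b \<in> B" "b - a \<in> C" using dom[OF C(1) a(1)] by blast
    have "real_exponent b \<in> ?L" using BL b(1) by blast
    moreover have "real_exponent (a - b) = 1 *\<^sub>R (real_exponent a - real_exponent b)"
      by (simp add: real_exponent_diff)
    ultimately have "a - b \<in> S1" unfolding S1_def using zero_less_one by blast
    then have "- (b - a) \<in> C" using C(2) by (auto simp: S_def)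
    then have "b - a = 0" using order_cone_antisym[OF C(1) b(2)] by blast
    then have "a \<in> B" using b(1) by simp
    then show False using a(2) BL by blast
  qed
qed

text \<open>Sets that lie below each other have the same attained maxima in every vertical
  fibre.\<close>

lemma upper_hat_subset_if_below:
  assumes MN: "M \<subseteq> {p. \<exists>s\<ge>0. p + (s, 0) \<in> N}" and NM: "N \<subseteq> {p. \<exists>s\<ge>0. p + (s, 0) \<in> M}"
  shows "upper_hat M \<subseteq> upper_hat (N :: (real \<times> 'v::comm_monoid_add) set)"
proof
  fix p assume "p \<in> upper_hat M"
  then obtain y0 y where p: "p = (y0, y)" "(y0, y) \<in> M" and top: "\<And>z. z > y0 \<Longrightarrow> (z, y) \<notin> M"
    unfolding upper_hat_def by blast
  have not_N: "(z, y) \<notin> N" if "z > y0" for z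
  proof
    assume "(z, y) \<in> N"
    then obtain s where "s \<ge> 0" "(z + s, y) \<in> M" using NM by auto
    then show False using top[of "z + s"] that by simp
  qed
  obtain s where "s \<ge> 0" "(y0 + s, y) \<in> N" using MN p(2) by auto
  then have "(y0, y) \<in> N" using not_N[of "y0 + s"] by (cases "s = 0") auto
  then show "p \<in> upper_hat N" using not_N by (simp add: upper_hat_def p(1))
qed

theorem upper_hat_eq_iff:
  fixes A B :: "(int \<times> (int ^ 'k::finite)) set"
  assumes "finite A" "finite B"
  shows "upper_hat (convex hull (real_exponent ` A)) = upper_hat (convex hull (real_exponent ` B))
    \<longleftrightarrow> (\<forall>C. order_cone C \<longrightarrow> {v. \<exists>a\<in>A. a - v \<in> C} = {v. \<exists>b\<in>B. b - v \<in> C})"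
proof
  assume hat: "upper_hat (convex hull (real_exponent ` A)) = upper_hat (convex hull (real_exponent ` B))"
  have hat_subset: "upper_hat N \<subseteq> N" for N :: "(real \<times> (real ^ 'k)) set"
    by (auto simp: upper_hat_def)
  have lower: "{v. \<exists>a\<in>A. a - v \<in> C} \<subseteq> {v. \<exists>b\<in>B. b - v \<in> C}"
    if C: "order_cone C" and A: "finite A"
      and hat: "upper_hat (convex hull (real_exponent ` A)) = upper_hat (convex hull (real_exponent ` B))"
    for C and A B :: "(int \<times> (int ^ 'k)) set"
  proof
    fix v assume "v \<in> {v. \<exists>a\<in>A. a - v \<in> C}"
    then obtain a where a: "a \<in> A" "a - v \<in> C" by blast
    obtain b where b: "b \<in> B" "b - a \<in> C"
      using dominated_if_hat_subset[OF C A a(1)] hat hat_subset by metis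
    have "(b - a) + (a - v) \<in> C"
      by (rule total_cone_add[OF order_imp_total_cone[OF C] b(2) a(2)])
    then show "v \<in> {v. \<exists>b\<in>B. b - v \<in> C}" using b(1) by auto
  qed
  show "\<forall>C. order_cone C \<longrightarrow> {v. \<exists>a\<in>A. a - v \<in> C} = {v. \<exists>b\<in>B. b - v \<in> C}"
    using lower[OF _ assms(1) hat] lower[OF _ assms(2) hat[symmetric]] by blast
next
  assume eq: "\<forall>C. order_cone C \<longrightarrow> {v. \<exists>a\<in>A. a - v \<in> C} = {v. \<exists>b\<in>B. b - v \<in> C}"
  have refl: "a - a \<in> C" if "order_cone C" for a C :: "_"
    using total_cone_zero[OF order_imp_total_cone[OF that]] by simp
  have "\<exists>b\<in>B. b - a \<in> C" if "order_cone C" "a \<in> A" for C a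
    using eq that refl by blast
  moreover have "\<exists>a\<in>A. a - b \<in> C" if "order_cone C" "b \<in> B" for C b
    using eq that refl by blast
  ultimately show "upper_hat (convex hull (real_exponent ` A)) = upper_hat (convex hull (real_exponent ` B))"
    by (intro equalityI upper_hat_subset_if_below hull_below_if_dominated)
qed

section \<open>A chain of cones\<close>

lemma zero_or_first_pos_append:
  "zero_or_first_pos (xs @ ys) \<Longrightarrow> zero_or_first_pos xs"
  by (induction xs) (auto simp: zero_or_first_pos_Cons)

lemma zero_or_first_pos_zeros_append:
  "\<forall>x\<in>set xs. x = 0 \<Longrightarrow> zero_or_first_pos (xs @ ys) \<longleftrightarrow> zero_or_first_pos ys"
  by (induction xs) (auto simp: zero_or_first_pos_Cons)

lemma mat_apply_append: "mat_apply (U @ V) v = mat_apply U v @ mat_apply V v"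
  by (simp add: mat_apply_def)

lemma matrix_cone_append: "matrix_cone (U @ V) \<subseteq> matrix_cone U"
  by (auto simp: matrix_cone_def mat_apply_append dest: zero_or_first_pos_append)

definition unit_exponent :: "'k option \<Rightarrow> int \<times> (int ^ 'k::finite)" where
  "unit_exponent z = (case z of None \<Rightarrow> (1, 0) | Some i \<Rightarrow> (0, axis i 1))"

lemma inner_unit_exponent:
  fixes y z :: "'k::finite option"
  shows "real_exponent (unit_exponent y) \<bullet> real_exponent (unit_exponent z) = (if y = z then 1 else 0)"
proof -
  have ax: "(\<chi> j. of_int (axis i 1 $ j)) = (axis i 1 :: real ^ 'k)" for i :: 'k
    by (simp add: vec_eq_iff axis_def)
  have z: "(\<chi> j. 0) = (0 :: real ^ 'k)" by (simp add: vec_eq_iff)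
  show ?thesis
    by (cases y; cases z) (auto simp: unit_exponent_def real_exponent_def inner_prod_def ax z inner_axis_axis)
qed

text \<open>Dropping the rows of the identity matrix one by one, from the lexicographic order down
  to the matrix with no rows, enlarges the cone k + 1 times.\<close>

lemma cone_chain:
  obtains D :: "nat \<Rightarrow> (int \<times> (int ^ 'k::finite)) set"
  where "\<And>i. i \<le> CARD('k) + 1 \<Longrightarrow> total_cone (D i)" "\<And>i. i < CARD('k) + 1 \<Longrightarrow> D i \<subset> D (Suc i)"
proof -
  obtain xs :: "'k list" where xs: "set xs = UNIV" "distinct xs"
    using finite_distinct_list[OF finite[of "UNIV :: 'k set"]] by blast
  \<comment> \<open>The row of t comes first, so every truncation still satisfies the sign condition
    on the first column.\<close>
  define zs where "zs = None # map Some xs"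
  have zs: "distinct zs" "length zs = CARD('k) + 1"
    using xs distinct_card[OF xs(2)] by (auto simp: zs_def distinct_map)
  define R where "R = map (\<lambda>z. real_exponent (unit_exponent z)) zs"
  define D where "D i = matrix_cone (take (CARD('k) + 1 - i) R)" for i
  have "total_cone (D i)" for i
    unfolding D_def
    by (intro total_cone_matrix_cone, cases "CARD('k) + 1 - i")
      (simp_all add: R_def zs_def zero_or_first_pos_Cons unit_exponent_def real_exponent_def)
  moreover have "D i \<subset> D (Suc i)" if i: "i < CARD('k) + 1" for i
  proof -
    define j where "j = CARD('k) - i"
    have j: "j < length zs" "CARD('k) + 1 - i = Suc j" "CARD('k) + 1 - Suc i = j"
      using i zs(2) by (auto simp: j_def)
    have take_Suc: "take (Suc j) R = take j R @ [R ! j]"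
      using j(1) by (simp add: R_def take_Suc_conv_app_nth)
    \<comment> \<open>Negative for the row that is dropped and orthogonal to the rows that remain,
      so it enters the cone exactly at this step.\<close>
    let ?v = "- unit_exponent (zs ! j)"
    have zeros: "\<forall>x\<in>set (mat_apply (take j R) (real_exponent ?v)). x = 0"
    proof -
      have "zs ! j \<notin> set (take j zs)"
        using zs(1) j(1) by (auto simp: in_set_conv_nth nth_eq_iff_index_eq)
      then show ?thesis
        by (auto simp: mat_apply_def R_def take_map real_exponent_uminus inner_unit_exponent)
    qed
    have "?v \<in> D (Suc i)"
      using zeros unfolding D_def j(3) by (simp add: matrix_cone_def zero_or_first_pos_def)
    moreover have "?v \<notin> D i"
      unfolding D_def j(2) take_Suc matrix_cone_def mem_Collect_eq mat_apply_append
        zero_or_first_pos_zeros_append[OF zeros]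
      using j(1) by (simp add: zero_or_first_pos_Cons R_def real_exponent_uminus inner_unit_exponent)
    moreover have "D i \<subseteq> D (Suc i)"
      unfolding D_def j(2,3) take_Suc by (rule matrix_cone_append)
    ultimately show ?thesis by blast
  qed
  ultimately show ?thesis using that by blast
qed

section \<open>Dimension\<close>

lemma monomial_power: "monomial a ^ n = monomial (nat_multiple n (a :: int \<times> 'm::comm_monoid_add))"
  by (induction n) (simp_all add: monomial_zero monomial_mult)

lemma monomial_prod: "(\<Prod>i\<in>A. monomial (h i)) = monomial (\<Sum>i\<in>A. h i :: int \<times> 'm::comm_monoid_add)"
  by (induction A rule: infinite_finite_induct) (simp_all add: monomial_zero monomial_mult)

text \<open>The elements t, x_1, ..., x_k. The option type makes their number k + 1, which becomes
  the bound on the length of chains.\<close>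

definition generator :: "'k option \<Rightarrow> ('n::comm_semiring_1 ^ 'k::finite) \<Rightarrow>\<^sub>0 zmax" where
  "generator z = (case z of None \<Rightarrow> monomial (1, 0) | Some i \<Rightarrow> monomial (0, axis i 1))"

lemma fst_nat_multiple: "fst (nat_multiple n p) = nat_multiple n (fst p)"
  and snd_nat_multiple: "snd (nat_multiple n p) = nat_multiple n (snd p)"
  by (induction n) simp_all

lemma nat_multiple_int: "nat_multiple n (x :: int) = int n * x"
  by (simp add: nat_multiple_def)

lemma nat_multiple_axis: "nat_multiple n (axis i 1) = axis i (of_nat n :: 'n::comm_semiring_1)"
  by (induction n) (simp_all add: vec_eq_iff axis_def)

lemma nat_multiple_zero: "nat_multiple n 0 = 0"
  by (induction n) simp_all

lemma power_product_generator:
  "power_product generator d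
    = monomial (int (d None), \<chi> i. of_nat (d (Some i)) :: 'n::comm_semiring_1 ^ 'k::finite)"
proof -
  have "power_product generator d
      = generator None ^ d None * (\<Prod>i\<in>UNIV. generator (Some i) ^ d (Some i) :: ('n ^ 'k) \<Rightarrow>\<^sub>0 zmax)"
    unfolding power_product_def UNIV_option_conv
    by (subst prod.insert) (auto simp: prod.reindex)
  also have "\<dots> = monomial (nat_multiple (d None) (1, 0) + (\<Sum>i\<in>UNIV. nat_multiple (d (Some i)) (0, axis i 1)))"
    by (simp add: generator_def monomial_power monomial_prod monomial_mult)
  also have "nat_multiple (d None) (1, 0) + (\<Sum>i\<in>UNIV. nat_multiple (d (Some i)) (0, axis i 1))
      = (int (d None), \<chi> i. of_nat (d (Some i)) :: 'n ^ 'k)"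
    by (simp add: prod_eq_iff vec_eq_iff fst_sum snd_sum fst_nat_multiple snd_nat_multiple
        nat_multiple_int nat_multiple_axis nat_multiple_zero)
      (simp add: axis_def if_distrib cong: if_cong)
  finally show ?thesis .
qed

lemma prime_equiv_monomial:
  assumes "prime_congruence P" "(f :: 'm::cancel_comm_monoid_add \<Rightarrow>\<^sub>0 zmax) \<noteq> 0"
  shows "\<exists>a\<in>terms f. (f, monomial a) \<in> P"
proof -
  interpret idempotent_prime P by unfold_locales (fact assms(1) zmax_poly_idem)+
  show ?thesis
    using sum_equiv_summand[of "terms f" monomial] assms(2) by (simp add: sum_terms terms_empty_iff)
qed

lemma prime_generating_if_monomials:
  fixes X :: "'i::finite \<Rightarrow> ('m::cancel_comm_monoid_add \<Rightarrow>\<^sub>0 zmax)"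
  assumes "\<And>a. \<exists>d e w. monomial a * power_product X d = power_product X e \<and> power_product X d * w = 1"
  shows "prime_generating X"
  unfolding prime_generating_def
proof (intro allI impI)
  fix P :: "('m \<Rightarrow>\<^sub>0 zmax) rel" and f assume P: "prime_congruence P"
  show "(f, 0) \<in> P \<or> (\<exists>u d e w. (f, u) \<in> P \<and> u * power_product X d = power_product X e
      \<and> power_product X d * w = 1)"
  proof (cases "f = 0")
    case True
    then show ?thesis using congruence_refl[OF prime_imp_congruence[OF P]] by simp
  next
    case False
    then show ?thesis using prime_equiv_monomial[OF P] assms by metis
  qed
qed

lemma (in exponent_embedding) dim_eq:
  assumes gen: "prime_generating (X :: 'k option \<Rightarrow> 'm \<Rightarrow>\<^sub>0 zmax)"
  shows "congruence_dim TYPE('m \<Rightarrow>\<^sub>0 zmax) = enat (CARD('k) + 1)"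
  unfolding congruence_dim_def
proof (rule antisym)
  have le: "n \<le> CARD('k) + 1" if "\<And>i. i \<le> n \<Longrightarrow> prime_congruence (Q i)" "\<And>i. i < n \<Longrightarrow> Q i \<subset> Q (Suc i)"
    for n and Q :: "nat \<Rightarrow> ('m \<Rightarrow>\<^sub>0 zmax) rel"
    using prime_chain_length_le[where C = Q and n = n, OF zmax_poly_idem gen that] by (simp add: card_UNIV_option)
  show "Sup {enat n | n. \<exists>Q :: nat \<Rightarrow> ('m \<Rightarrow>\<^sub>0 zmax) rel.
     (\<forall>i\<le>n. prime_congruence (Q i)) \<and> (\<forall>i<n. Q i \<subset> Q (Suc i))} \<le> enat (CARD('k) + 1)"
  proof (rule Sup_least)
    fix m assume "m \<in> {enat n | n. \<exists>Q :: nat \<Rightarrow> ('m \<Rightarrow>\<^sub>0 zmax) rel.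
     (\<forall>i\<le>n. prime_congruence (Q i)) \<and> (\<forall>i<n. Q i \<subset> Q (Suc i))}"
    then obtain n and Q :: "nat \<Rightarrow> ('m \<Rightarrow>\<^sub>0 zmax) rel" where m: "m = enat n"
      and Q: "\<forall>i\<le>n. prime_congruence (Q i)" "\<forall>i<n. Q i \<subset> Q (Suc i)" by blast
    have "n \<le> CARD('k) + 1" by (rule le[of n Q]) (use Q in blast)+
    then show "m \<le> enat (CARD('k) + 1)" by (simp add: m)
  qed
  obtain D :: "nat \<Rightarrow> (int \<times> (int ^ 'k)) set"
    where D: "\<And>i. i \<le> CARD('k) + 1 \<Longrightarrow> total_cone (D i)" "\<And>i. i < CARD('k) + 1 \<Longrightarrow> D i \<subset> D (Suc i)"
    by (rule cone_chain) blast
  have strict: "cone_congruence (D i) \<subset> cone_congruence (D (Suc i))" if "i < CARD('k) + 1" for i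
    using cone_congruence_mono_iff[of "D i" "D (Suc i)"] cone_congruence_mono_iff[of "D (Suc i)" "D i"]
      D(1)[of i] D(1)[of "Suc i"] D(2)[of i] that by auto
  show "enat (CARD('k) + 1) \<le> Sup {enat n | n. \<exists>Q :: nat \<Rightarrow> ('m \<Rightarrow>\<^sub>0 zmax) rel.
     (\<forall>i\<le>n. prime_congruence (Q i)) \<and> (\<forall>i<n. Q i \<subset> Q (Suc i))}"
    by (intro Sup_upper CollectI exI[of _ "CARD('k) + 1"] exI[of _ "\<lambda>i. cone_congruence (D i)"]
        conjI allI impI refl prime_cone_congruence D(1) strict)
qed

section \<open>Radicals\<close>

lemma (in exponent_embedding) Rad_trivial_iff_upper_hat:
  "(f, g) \<in> congruence_Rad Id \<longleftrightarrow>
    upper_hat (convex hull (real_exponent ` ex ` terms f)) = upper_hat (convex hull (real_exponent ` ex ` terms g))"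
  unfolding Rad_trivial
  by (subst upper_hat_eq_iff) (auto simp: cone_congruence_def down_def)

lemma semiring_congruence_Rad: "semiring_congruence (congruence_Rad I)"
  unfolding congruence_Rad_def by (intro semiring_congruence_Inter) (auto intro: prime_imp_congruence)

text \<open>The intersection runs over congruences of order cones, modulo which only 0 is equivalent
  to 0, so a nonzero factor cancels in each of them. This avoids primes that identify a variable
  with 0.\<close>

lemma (in exponent_embedding) QC_Rad_trivial:
  "QC_congruence (congruence_Rad (Id :: ('m \<Rightarrow>\<^sub>0 zmax) rel))"
proof -
  let ?R = "congruence_Rad (Id :: ('m \<Rightarrow>\<^sub>0 zmax) rel)"
  note cong = semiring_congruence_Rad[of "Id :: ('m \<Rightarrow>\<^sub>0 zmax) rel"]
  obtain C :: "(int \<times> (int ^ 'k)) set" where C: "order_cone C" using order_cone_exists by blast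
  have "(1, 0) \<notin> ?R"
    using cone_congruence_zero[OF order_imp_total_cone[OF C], of 1] C unfolding Rad_trivial by auto
  moreover have "(a, 0) \<in> ?R \<or> (b, c) \<in> ?R" if abc: "(a * b, a * c) \<in> ?R" for a b c
  proof (cases "a = 0")
    case True
    then show ?thesis using congruence_refl[OF cong] by simp
  next
    case False
    have "(b, c) \<in> cone_congruence C" if C: "order_cone C" for C
    proof -
      note tot = order_imp_total_cone[OF C]
      have "(a * b, a * c) \<in> cone_congruence C" using abc C unfolding Rad_trivial by blast
      then show ?thesis
        using prime_cancel[OF prime_cone_congruence[OF tot]] cone_congruence_zero[OF tot] False by blast
    qed
    then show ?thesis unfolding Rad_trivial by blast
  qed
  ultimately show ?thesis
    unfolding QC_congruence_def proper_congruence_def congruence_class_eq_iff[OF cong]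
    using cong by blast
qed

text \<open>A nonzero Laurent polynomial is equivalent to one of its terms, and a Laurent monomial
  is a unit.\<close>

lemma laurent_prime_zero:
  assumes P: "prime_congruence P" and f: "(f, 0) \<in> P"
  shows "(f :: ('k::finite) zmax_laurent) = 0"
proof (rule ccontr)
  note cong = prime_imp_congruence[OF P]
  assume "f \<noteq> 0"
  then obtain a where "(f, monomial a) \<in> P" using prime_equiv_monomial[OF P] by blast
  then have "(monomial a, 0) \<in> P" using f congruence_sym[OF cong] congruence_trans[OF cong] by blast
  then have "(monomial a * monomial (- a), 0 * monomial (- a)) \<in> P"
    by (intro congruence_mult[OF cong] congruence_refl[OF cong])
  then show False using prime_one_zero[OF P] by (simp add: monomial_mult monomial_zero)
qed

text \<open>A nonzero \<open>a\<close> vanishes modulo no prime, so it cancels modulo every prime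
  above \<open>I\<close> and hence modulo their intersection.\<close>

lemma laurent_radical_QC:
  fixes I :: "('k::finite) zmax_laurent rel"
  assumes "proper_congruence I" "radical_congruence I"
  shows "QC_congruence I"
proof -
  have cong: "semiring_congruence I" and Rad: "congruence_Rad I = I"
    using assms(2) by (simp_all add: radical_congruence_def)
  have "(a, 0) \<in> I \<or> (b, c) \<in> I" if abc: "(a * b, a * c) \<in> I" for a b c
  proof (cases "a = 0")
    case True
    then show ?thesis using congruence_refl[OF cong] by simp
  next
    case False
    have "(b, c) \<in> P" if "prime_congruence P" "I \<subseteq> P" for P
      using prime_cancel[OF that(1)] laurent_prime_zero[OF that(1)] abc that(2) False by blast
    then have "(b, c) \<in> congruence_Rad I" by (simp add: congruence_Rad_def)
    then show ?thesis using Rad by simp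
  qed
  then show ?thesis
    unfolding QC_congruence_def congruence_class_eq_iff[OF cong] using assms(1) by blast
qed

section \<open>Polynomials as Laurent polynomials\<close>

interpretation poly: exponent_embedding "\<lambda>n :: nat ^ 'k::finite. \<chi> i. int (n $ i)"
proof
  show "inj (\<lambda>n :: nat ^ 'k. \<chi> i. int (n $ i))"
    by (simp add: inj_def vec_eq_iff)
  fix v :: "int ^ 'k"
  have "v = (\<chi> i. int ((\<chi> i. nat (v $ i)) $ i)) - (\<chi> i. int ((\<chi> i. nat (- v $ i)) $ i))"
    by (simp add: vec_eq_iff)
  then show "\<exists>m n. v = (\<chi> i. int (m $ i)) - (\<chi> i. int (n $ i))" by blast
qed (simp add: vec_eq_iff)

text \<open>The bridge from polynomials, whose polytopes and restricted congruences are defined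
  through Laurent polynomials, to the embedding \<open>poly.ex\<close>.\<close>

lemma terms_laurent_of_poly: "terms (laurent_of_poly f) = poly.ex ` terms (f :: ('k::finite) zmax_poly)"
proof -
  let ?e = "\<lambda>n :: nat ^ 'k. (\<chi> i. int (n $ i)) :: int ^ 'k"
  have e: "?e m = ?e n \<longleftrightarrow> m = n" for m n by (simp add: vec_eq_iff)
  have lk: "Poly_Mapping.lookup (laurent_of_poly f) v
      = (\<Sum>n\<in>Poly_Mapping.keys f. if ?e n = v then Poly_Mapping.lookup f n else 0)" for v
    by (simp add: laurent_of_poly_def lookup_sum lookup_single when_def)
  have lk_e: "Poly_Mapping.lookup (laurent_of_poly f) (?e m) = Poly_Mapping.lookup f m" for m
    unfolding lk e by (simp add: in_keys_iff)
  have lk_0: "Poly_Mapping.lookup (laurent_of_poly f) v = 0" if "v \<notin> range ?e" for v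
    unfolding lk using that by (intro sum.neutral) auto
  have ex: "poly.ex (c, n) = (c, ?e n)" for c and n :: "nat ^ 'k" by (simp add: poly.ex_def)
  show ?thesis
  proof (intro equalityI subsetI)
    fix a assume a: "a \<in> terms (laurent_of_poly f)"
    then have "snd a \<in> range ?e" using lk_0[of "snd a"] by (auto simp: terms_def zero_zmax_def)
    then obtain n where n: "snd a = ?e n" by blast
    then have "(fst a, n) \<in> terms f" using a lk_e by (simp add: terms_def)
    moreover have "a = poly.ex (fst a, n)" by (simp add: ex n[symmetric])
    ultimately show "a \<in> poly.ex ` terms f" by blast
  next
    fix a assume "a \<in> poly.ex ` terms f"
    then show "a \<in> terms (laurent_of_poly f)" by (auto simp: terms_def ex lk_e)
  qed
qed

lemma newt_eq: "newt f = convex hull (real_exponent ` terms f)"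
proof -
  have "{real_exponent (c, n) | c n. Poly_Mapping.lookup f n = TPow c} = real_exponent ` terms f"
    by (force simp: terms_def)
  then show ?thesis by (simp add: newt_def)
qed

lemma P_cong_poly_Z_eq:
  fixes U :: "('k::finite) real_matrix"
  assumes "zero_or_first_pos (map fst U)"
  shows "P_cong_poly_Z U = poly.cone_congruence (matrix_cone U)"
  by (simp add: P_cong_poly_Z_def P_cong_Z_eq[OF assms] laurent.cone_congruence_def
      poly.cone_congruence_def laurent.down_def poly.down_def terms_laurent_of_poly)

lemma prime_generating_laurent:
  "prime_generating (generator :: 'k option \<Rightarrow> ('k::finite) zmax_laurent)"
proof (rule prime_generating_if_monomials)
  fix a :: "int \<times> (int ^ 'k)"
  define d where "d z = (case z of None \<Rightarrow> nat (- fst a) | Some i \<Rightarrow> nat (- snd a $ i))" for z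
  define e where "e z = (case z of None \<Rightarrow> nat (fst a) | Some i \<Rightarrow> nat (snd a $ i))" for z
  have "monomial a * power_product generator d = power_product generator e"
    unfolding power_product_generator monomial_mult
    by (rule arg_cong[where f = monomial]) (simp add: prod_eq_iff vec_eq_iff d_def e_def)
  moreover have "\<exists>w. power_product generator d * w = (1 :: 'k zmax_laurent)"
    unfolding power_product_generator using monomial_mult monomial_zero by (metis add.right_inverse)
  ultimately show "\<exists>d e w. monomial a * power_product generator d = power_product generator e
      \<and> power_product generator d * w = (1 :: 'k zmax_laurent)" by blast
qed

text \<open>Only the exponent of t can be negative, so a power of t serves as denominator; it is a
  unit although the variables are not.\<close>

lemma prime_generating_poly:
  "prime_generating (generator :: 'k option \<Rightarrow> ('k::finite) zmax_poly)"
proof (rule prime_generating_if_monomials)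
  fix a :: "int \<times> (nat ^ 'k)"
  define d :: "'k option \<Rightarrow> nat" where "d z = (case z of None \<Rightarrow> nat (- fst a) | Some i \<Rightarrow> 0)" for z
  define e where "e z = (case z of None \<Rightarrow> nat (fst a) | Some i \<Rightarrow> snd a $ i)" for z
  have "monomial a * power_product generator d = power_product generator e"
    unfolding power_product_generator monomial_mult
    by (rule arg_cong[where f = monomial]) (simp add: prod_eq_iff vec_eq_iff d_def e_def)
  moreover have "power_product generator d * monomial (- int (d None), 0) = (1 :: 'k zmax_poly)"
    unfolding power_product_generator monomial_mult monomial_zero[symmetric]
    by (rule arg_cong[where f = monomial]) (simp add: prod_eq_iff vec_eq_iff d_def)
  ultimately show "\<exists>d e w. monomial a * power_product generator d = power_product generator e
      \<and> power_product generator d * w = (1 :: 'k zmax_poly)" by blast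
qed

theorem theorem4p10:
  shows
    "{P :: ('k::finite) zmax_laurent rel. minimal_prime_congruence P} =
       {P_cong_Z U | U. z_admissible U \<and> mat_Ker U \<inter> range real_exponent = {0}}
   \<and> {P :: 'k zmax_poly rel. minimal_prime_congruence P} =
       {P_cong_poly_Z U | U. z_admissible U \<and> mat_Ker U \<inter> range real_exponent = {0}}
   \<and> congruence_dim TYPE('k zmax_laurent) = enat (CARD('k) + 1)
   \<and> congruence_dim TYPE('k zmax_poly) = enat (CARD('k) + 1)
   \<and> (\<forall>f g :: 'k zmax_laurent.
        (f, g) \<in> congruence_Rad Id \<longleftrightarrow> upper_hat (newt f) = upper_hat (newt g))
   \<and> (\<forall>f g :: 'k zmax_poly.
        (f, g) \<in> congruence_Rad Id \<longleftrightarrow> upper_hat (newt_poly f) = upper_hat (newt_poly g))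
   \<and> (\<forall>I :: 'k zmax_laurent rel.
        proper_congruence I \<and> radical_congruence I \<longrightarrow> QC_congruence I)
   \<and> QC_congruence (congruence_Rad (Id :: 'k zmax_poly rel))"
proof (intro conjI allI impI)
  let ?M = "{U :: 'k real_matrix. z_admissible U \<and> mat_Ker U \<inter> range real_exponent = {0}}"
  have M: "zero_or_first_pos (map fst U)" if "U \<in> ?M" for U
    using that by (simp add: z_admissible_def)
  have "{P :: 'k zmax_laurent rel. minimal_prime_congruence P}
      = laurent.cone_congruence ` Collect order_cone"
    unfolding laurent.minimal_prime_congruences by blast
  also have "\<dots> = P_cong_Z ` ?M"
    unfolding order_cones_eq_matrix_cones image_image by (intro image_cong refl) (simp add: P_cong_Z_eq M)
  finally show "{P :: 'k zmax_laurent rel. minimal_prime_congruence P} =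
       {P_cong_Z U | U. z_admissible U \<and> mat_Ker U \<inter> range real_exponent = {0}}" by blast
  have "{P :: 'k zmax_poly rel. minimal_prime_congruence P}
      = poly.cone_congruence ` Collect order_cone"
    unfolding poly.minimal_prime_congruences by blast
  also have "\<dots> = P_cong_poly_Z ` ?M"
    unfolding order_cones_eq_matrix_cones image_image by (intro image_cong refl) (simp add: P_cong_poly_Z_eq M)
  finally show "{P :: 'k zmax_poly rel. minimal_prime_congruence P} =
       {P_cong_poly_Z U | U. z_admissible U \<and> mat_Ker U \<inter> range real_exponent = {0}}" by blast
  show "congruence_dim TYPE('k zmax_laurent) = enat (CARD('k) + 1)"
    by (rule laurent.dim_eq[OF prime_generating_laurent])
  show "congruence_dim TYPE('k zmax_poly) = enat (CARD('k) + 1)"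
    by (rule poly.dim_eq[OF prime_generating_poly])
  show "(f, g) \<in> congruence_Rad Id \<longleftrightarrow> upper_hat (newt f) = upper_hat (newt g)"
    for f g :: "'k zmax_laurent"
    by (simp add: laurent.Rad_trivial_iff_upper_hat newt_eq)
  show "(f, g) \<in> congruence_Rad Id \<longleftrightarrow> upper_hat (newt_poly f) = upper_hat (newt_poly g)"
    for f g :: "'k zmax_poly"
    by (simp add: poly.Rad_trivial_iff_upper_hat newt_poly_def newt_eq terms_laurent_of_poly)
  show "QC_congruence I" if "proper_congruence I \<and> radical_congruence I" for I :: "'k zmax_laurent rel"
    using that laurent_radical_QC by blast
  show "QC_congruence (congruence_Rad (Id :: 'k zmax_poly rel))"
    by (rule poly.QC_Rad_trivial)
qed

end
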